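(* Let $(W,S)$ be a Coxeter system (with $S$ finite) with Dynkin diagram $\Delta=\Delta(W,S)$ and hypergraph index $h=h(W,S)$. If $h$ is finite then $h\le \mathrm{b}_1(\Delta)+1$.
   Context: Coxeter systems: $W=\langle S\mid (st)^{m_{st}}=1\rangle$ with $S$ finite, $m_{ss}=1$ and $m_{st}=m_{ts}\in\{2,3,\dots\}\cup\{\infty\}$ for $s\neq t$ ($\infty$ meaning that $st$ has infinite order). The Dynkin diagram $\Delta(W,S)$ is the simplicial graph with vertex set $S$ and an edge labelled $m_{st}$ between distinct $s,t$ whenever $m_{st}\ge 3$ (including $m_{st}=\infty$). The first Betti number of a graph with $v$ vertices, $e$ edges and $k$ components is $\mathrm{b}_1=e-v+k$. For $T\subseteq S$, $W_T=\langle T\rangle$, and $(W_T,T)$ is a Coxeter system. $T$ is spherical if $W_T$ is finite and nonspherical otherwise; minimal nonspherical if it is nonspherical but all its proper subsets are spherical; irreducible if it has no nontrivial partition into two disjoint commuting subsets; affine if $(W_T,T)$ is affine, i.e. $T$ is the set of reflections in the faces of a compact polytope in Euclidean space. For $A,B\subseteq S$, $A\times B$ denotes $A\cup B$ where $A$ and $B$ are disjoint commuting subsets of $S$. Hypergraph index: The wide subsets $\Omega(S)$ are the maximal elements (under inclusion) of the collection of subsets of $S$ of the form $A\times B$ such that either $A$ and $B$ are both nonspherical, or $A$ is irreducible affine of cardinality $\ge 3$ and $B$ is spherical (possibly empty). The slab subsets $\Psi(S)$ are the maximal elements of the collection of subsets of $S$ of the form $A\times K$ where $A$ is minimal nonspherical,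 $K$ is a nonempty spherical subset commuting with $A$, and there is no $T\in\Omega(S)$ with $A\times K\subseteq T$. Put $\Lambda_{-1}(S)=\varnothing$ and $\Lambda_0(S)=\Omega(S)\cup\Psi(S)$. For $i\ge 0$ and $T,T'\in\Lambda_i(S)$, write $T\equiv_i T'$ if there are $T=T_0,T_1,\dots,T_n=T'$ in $\Lambda_i(S)$ with $T_j\cap T_{j+1}$ nonspherical for $0\le j<n$; then $\Lambda_{i+1}(S)$ is the set of all unions $\bigcup_{T\in C}T$ with $C$ an $\equiv_i$-equivalence class in $\Lambda_i(S)$. The hypergraph index is $h(W,S)=h\in\mathbb{N}\cup\{0\}$ if $S\in\Lambda_h(S)\setminus\Lambda_{h-1}(S)$ and $\Omega(S)\neq\varnothing$; if no such $h$ exists, or $\Omega(S)=\varnothing$, then $h(W,S)=\infty$. *)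

theory Defs
  imports "HOL-Analysis.Analysis" "HOL-Algebra.Generated_Groups" "HOL-Algebra.Group_Action"
    "HOL-Library.Extended_Nat"
begin

section \<open>Coxeter systems\<close>

text \<open>
  The set \<open>S\<close> of Coxeter generators is the universe of a finite type, and
  \<open>\<sigma>\<close> embeds it into the group \<open>W\<close>; subsets of \<open>S\<close> are sets over that type.
\<close>

definition coxeter_matrix :: "('s \<Rightarrow> 's \<Rightarrow> enat) \<Rightarrow> bool" where
  "coxeter_matrix m \<longleftrightarrow>
     (\<forall>s. m s s = 1) \<and> (\<forall>s t. m s t = m t s) \<and> (\<forall>s t. s \<noteq> t \<longrightarrow> 2 \<le> m s t)"

definition word_val :: "('w, 'b) monoid_scheme \<Rightarrow> ('s \<Rightarrow> 'w) \<Rightarrow> 's list \<Rightarrow> 'w" where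
  "word_val W \<sigma> w = foldr (\<lambda>s g. \<sigma> s \<otimes>\<^bsub>W\<^esub> g) w \<one>\<^bsub>W\<^esub>"

inductive delete_relator :: "('s \<Rightarrow> 's \<Rightarrow> enat) \<Rightarrow> 's list \<Rightarrow> 's list \<Rightarrow> bool" for m where
  "m s t = enat k \<Longrightarrow> delete_relator m (u @ concat (replicate k [s, t]) @ v) (u @ v)"

text \<open>
  \<open>W\<close> is presented by the generators \<open>S\<close> and the relations \<open>(st)\<^sup>m = 1\<close>, \<open>m = m s t < \<infinity>\<close>.
  Since \<open>m s s = 1\<close> makes each \<open>ss\<close> a relator, formal inverses of letters are not needed, and two
  words represent the same element of the presented group iff they are related by finitely many
  insertions and deletions of relators.
\<close>

definition coxeter_system ::
  "('w, 'b) monoid_scheme \<Rightarrow> ('s::finite \<Rightarrow> 'w) \<Rightarrow> ('s \<Rightarrow> 's \<Rightarrow> enat) \<Rightarrow> bool" where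
  "coxeter_system W \<sigma> m \<longleftrightarrow>
     group W \<and> coxeter_matrix m \<and> range \<sigma> \<subseteq> carrier W \<and> generate W (range \<sigma>) = carrier W \<and>
     (\<forall>v w. word_val W \<sigma> v = word_val W \<sigma> w \<longleftrightarrow> equivclp (delete_relator m) v w)"

section \<open>Dynkin diagram and first Betti number\<close>

definition dynkin_edges :: "('s \<Rightarrow> 's \<Rightarrow> enat) \<Rightarrow> 's set set" where
  "dynkin_edges m = {{s, t} | s t. s \<noteq> t \<and> 3 \<le> m s t}"

definition graph_components :: "'v set \<Rightarrow> 'v set set \<Rightarrow> 'v set set" where
  "graph_components V E = V // {(x, y) \<in> V \<times> V. (x, y) \<in> {(a, b). {a, b} \<in> E}\<^sup>*}"

definition first_betti :: "'v set \<Rightarrow> 'v set set \<Rightarrow> int" where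
  "first_betti V E = int (card E) - int (card V) + int (card (graph_components V E))"

section \<open>Types of subsets of the generating set\<close>

definition special_subgroup ::
  "('w, 'b) monoid_scheme \<Rightarrow> ('s \<Rightarrow> 'w) \<Rightarrow> 's set \<Rightarrow> ('w, 'b) monoid_scheme" where
  "special_subgroup W \<sigma> T = subgroup_generated W (\<sigma> ` T)"

definition spherical :: "('w, 'b) monoid_scheme \<Rightarrow> ('s \<Rightarrow> 'w) \<Rightarrow> 's set \<Rightarrow> bool" where
  "spherical W \<sigma> T \<longleftrightarrow> finite (carrier (special_subgroup W \<sigma> T))"

definition minimal_nonspherical :: "('w, 'b) monoid_scheme \<Rightarrow> ('s \<Rightarrow> 'w) \<Rightarrow> 's set \<Rightarrow> bool" where
  "minimal_nonspherical W \<sigma> T \<longleftrightarrow> \<not> spherical W \<sigma> T \<and> (\<forall>U. U \<subset> T \<longrightarrow> spherical W \<sigma> U)"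

text \<open>The product notation \<open>A \<times> B\<close> stands for \<open>A \<union> B\<close> subject to the following condition.\<close>

definition disjoint_commuting ::
  "('w, 'b) monoid_scheme \<Rightarrow> ('s \<Rightarrow> 'w) \<Rightarrow> 's set \<Rightarrow> 's set \<Rightarrow> bool" where
  "disjoint_commuting W \<sigma> A B \<longleftrightarrow>
     A \<inter> B = {} \<and> (\<forall>a\<in>A. \<forall>b\<in>B. \<sigma> a \<otimes>\<^bsub>W\<^esub> \<sigma> b = \<sigma> b \<otimes>\<^bsub>W\<^esub> \<sigma> a)"

definition irreducible_subset :: "('w, 'b) monoid_scheme \<Rightarrow> ('s \<Rightarrow> 'w) \<Rightarrow> 's set \<Rightarrow> bool" where
  "irreducible_subset W \<sigma> T \<longleftrightarrow>
     \<not> (\<exists>A B. A \<noteq> {} \<and> B \<noteq> {} \<and> A \<union> B = T \<and> disjoint_commuting W \<sigma> A B)"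

text \<open>
  Reflection in the affine span of a face \<open>F\<close>. If \<open>F\<close> is a facet of \<open>P\<close>, then on the Euclidean
  space \<open>affine hull P\<close> this is the orthogonal reflection in the hyperplane spanned by \<open>F\<close>.
\<close>

definition face_reflection :: "'e::euclidean_space set \<Rightarrow> 'e \<Rightarrow> 'e" where
  "face_reflection F x = 2 *\<^sub>R closest_point (affine hull F) x - x"

text \<open>
  \<open>(W\<^sub>T, T)\<close> is affine if \<open>W\<^sub>T\<close> acts faithfully on a Euclidean space \<open>E\<close> so that \<open>T\<close> is
  the set of reflections in the codimension-one faces of a compact polytope \<open>P\<close> spanning \<open>E\<close>.
  As always for Euclidean reflection groups, \<open>P\<close> is a fundamental polytope: its translates
  tile \<open>E\<close>. (Reflections in the faces of a polytope with arbitrary dihedral angles generate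
  non-discrete groups, and these can even be free products of copies of the group of order two.)

  The space \<open>E\<close> ranges over the affine subspaces of \<open>\<real>\<^sup>S\<close>. This covers all dimensions that
  can occur: a polytope of dimension \<open>d \<ge> 1\<close> has more than \<open>d\<close> facets, so \<open>d < card T \<le> card S\<close>.
\<close>

definition affine_subset ::
  "('w, 'b) monoid_scheme \<Rightarrow> ('s::finite \<Rightarrow> 'w) \<Rightarrow> 's set \<Rightarrow> bool" where
  "affine_subset W \<sigma> T \<longleftrightarrow>
     (\<exists>(P :: (real ^ 's) set) F \<phi>.
        polytope P \<and> P \<noteq> {} \<and> bij_betw F T {G. G facet_of P} \<and>
        faithful_action (special_subgroup W \<sigma> T) (affine hull P) \<phi> \<and>
        (\<forall>t\<in>T. \<forall>x\<in>affine hull P. \<phi> (\<sigma> t) x = face_reflection (F t) x) \<and>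
        (\<Union>g\<in>carrier (special_subgroup W \<sigma> T). \<phi> g ` P) = affine hull P \<and>
        (\<forall>g\<in>carrier (special_subgroup W \<sigma> T).
           g \<noteq> \<one>\<^bsub>W\<^esub> \<longrightarrow> rel_interior P \<inter> \<phi> g ` rel_interior P = {}))"

section \<open>Hypergraph index\<close>

definition maximal_sets :: "'a set set \<Rightarrow> 'a set set" where
  "maximal_sets C = {T \<in> C. \<forall>U\<in>C. T \<subseteq> U \<longrightarrow> U = T}"

definition wide_subsets :: "('w, 'b) monoid_scheme \<Rightarrow> ('s::finite \<Rightarrow> 'w) \<Rightarrow> 's set set" where
  "wide_subsets W \<sigma> = maximal_sets
     {A \<union> B | A B. disjoint_commuting W \<sigma> A B \<and>
        (\<not> spherical W \<sigma> A \<and> \<not> spherical W \<sigma> B \<or>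
         irreducible_subset W \<sigma> A \<and> affine_subset W \<sigma> A \<and> 3 \<le> card A \<and> spherical W \<sigma> B)}"

definition slab_subsets :: "('w, 'b) monoid_scheme \<Rightarrow> ('s::finite \<Rightarrow> 'w) \<Rightarrow> 's set set" where
  "slab_subsets W \<sigma> = maximal_sets
     {A \<union> K | A K. disjoint_commuting W \<sigma> A K \<and>
        minimal_nonspherical W \<sigma> A \<and> K \<noteq> {} \<and> spherical W \<sigma> K \<and>
        \<not> (\<exists>T\<in>wide_subsets W \<sigma>. A \<union> K \<subseteq> T)}"

definition merge_rel ::
  "('w, 'b) monoid_scheme \<Rightarrow> ('s \<Rightarrow> 'w) \<Rightarrow> 's set set \<Rightarrow> ('s set \<times> 's set) set" where
  "merge_rel W \<sigma> L =
     {(T, U) \<in> L \<times> L. (T, U) \<in> {(T, U). T \<in> L \<and> U \<in> L \<and> \<not> spherical W \<sigma> (T \<inter> U)}\<^sup>*}"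

primrec hypergraph_level ::
  "('w, 'b) monoid_scheme \<Rightarrow> ('s::finite \<Rightarrow> 'w) \<Rightarrow> nat \<Rightarrow> 's set set" where
  "hypergraph_level W \<sigma> 0 = wide_subsets W \<sigma> \<union> slab_subsets W \<sigma>"
| "hypergraph_level W \<sigma> (Suc i) =
     Union ` (hypergraph_level W \<sigma> i // merge_rel W \<sigma> (hypergraph_level W \<sigma> i))"

text \<open>The disjunct \<open>h = 0\<close> accounts for the convention that level \<open>-1\<close> is empty.\<close>

definition enters_at_level ::
  "('w, 'b) monoid_scheme \<Rightarrow> ('s::finite \<Rightarrow> 'w) \<Rightarrow> nat \<Rightarrow> bool" where
  "enters_at_level W \<sigma> h \<longleftrightarrow>
     UNIV \<in> hypergraph_level W \<sigma> h \<and> (h = 0 \<or> UNIV \<notin> hypergraph_level W \<sigma> (h - 1))"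

text \<open>
  All members of a level are nonspherical, so once \<open>S\<close> belongs to a level all later levels are
  \<open>{S}\<close>; hence at most one \<open>h\<close> satisfies \<open>enters_at_level\<close>, and it is what \<open>LEAST\<close> selects.
\<close>

definition hypergraph_index :: "('w, 'b) monoid_scheme \<Rightarrow> ('s::finite \<Rightarrow> 'w) \<Rightarrow> enat" where
  "hypergraph_index W \<sigma> =
     (if wide_subsets W \<sigma> \<noteq> {} \<and> (\<exists>h. enters_at_level W \<sigma> h)
      then enat (LEAST h. enters_at_level W \<sigma> h) else \<infinity>)"

end

theory Submission
  imports Defs
begin

text \<open>
  Call a set of generators minimal if it is minimal nonspherical. Such a set is connected in the
  Dynkin diagram, and every member of level 0 either contains two disjoint commuting minimal sets
  (it \<^emph>\<open>splits\<close>) or has the form \<open>A \<times> K\<close> with \<open>A\<close> minimal and \<open>K\<close> spherical, so that \<open>A\<close> is its only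
  minimal subset (it is a \<^emph>\<open>cone over\<close> \<open>A\<close>). Conversely, level 0 covers every product of two commuting
  minimal sets, and every minimal set together with one generator that commutes with it.

  The theorem follows from a growth statement for induced subdiagrams (\<open>first_betti_grows\<close>): if \<open>T\<close>
  appears at level \<open>i + 1\<close> for the first time, then the diagram induced on \<open>T\<close> has first Betti number at
  least \<open>i\<close>. The case \<open>T = S\<close>, \<open>h = i + 1\<close> is the claim. It is proved by induction on \<open>i\<close>. Because \<open>T\<close> is
  new, it contains two incomparable members \<open>T\<^sub>0\<close>, \<open>T\<^sub>1\<close> of the previous level whose intersection is
  nonspherical (\<open>incomparable_members\<close>); let \<open>M\<close> be a minimal set in this intersection. Both are
  unions of merging classes of the level before, and if each of these classes had a member that
  contains \<open>M\<close>, the classes would coincide. So one of them, say \<open>C\<close>, has no such member. Its union \<open>U\<close> is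
  then itself new, so the induction hypothesis applies to \<open>U\<close>, and \<open>T\<close> contains a generator \<open>x\<close>
  outside \<open>U\<close>.

  It remains to see that adding \<open>x\<close> to \<open>U\<close> creates a cycle (\<open>new_cycle\<close>). Decompose \<open>U\<close> into members
  of level 0, its constituents. They form a family that is closed under nonspherical intersection
  within level 0, and none of them contains \<open>M\<close>. If a minimal set \<open>N\<close> lies in a constituent, then \<open>N\<close> and
  \<open>M\<close> lie in the same component of the diagram induced on \<open>U\<close>: otherwise they commute, level 0 covers
  \<open>N \<times> M\<close>, and closedness makes this covering set a constituent that contains \<open>M\<close>. Likewise \<open>x\<close> is
  adjacent to \<open>N\<close>, since otherwise a constituent would contain \<open>x\<close>. If some constituent splits, it contains
  two disjoint sets \<open>N\<close>, so \<open>x\<close> has two neighbours in one component of \<open>U\<close>, and the Betti number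
  goes up. If no constituent splits, then at each level the linked members are cones over the same set, so
  \<open>U\<close> is a cone over a set contained in every constituent (\<open>split_or_cone_class\<close>); this set is the only
  minimal subset of \<open>U\<close>, hence equal to \<open>M\<close>, a contradiction.

  Two facts about the group connect this combinatorics with the definitions. Noncommuting generators
  are adjacent in the Dynkin diagram, because two involutions commute when their product squares to
  one (\<open>noncommuting_dynkin_edge\<close>). An irreducible affine set is minimal nonspherical (\<open>affine_irreducible_minimal\<close>): the outer unit
  normals of the fundamental polytope have pairwise nonpositive inner products, irreducibility makes
  any proper subset of them linearly independent, and so a proper subset of the reflections fixes a
  common point and generates a finite group.
\<close>

section \<open>First Betti numbers of finite graphs\<close>

definition induced_edges :: "'v set set \<Rightarrow> 'v set \<Rightarrow> 'v set set" where
  "induced_edges E T = {e \<in> E. e \<subseteq> T}"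

text \<open>
  Loops are allowed: they count as cycles, and all statements about Betti numbers below hold for them.
\<close>

definition edges_within :: "'v set \<Rightarrow> 'v set set \<Rightarrow> bool" where
  "edges_within V E \<longleftrightarrow> (\<forall>e\<in>E. \<exists>a\<in>V. \<exists>b\<in>V. e = {a, b})"

abbreviation adjacency :: "'v set set \<Rightarrow> ('v \<times> 'v) set" where
  "adjacency E \<equiv> {(a, b). {a, b} \<in> E}"

definition connectivity :: "'v set \<Rightarrow> 'v set set \<Rightarrow> ('v \<times> 'v) set" where
  "connectivity V E = {(x, y) \<in> V \<times> V. (x, y) \<in> (adjacency E)\<^sup>*}"

lemma graph_components_eq: "graph_components V E = V // connectivity V E"
  by (simp add: graph_components_def connectivity_def)

lemma sym_adjacency: "sym (adjacency E)"
  by (auto simp: sym_def insert_commute)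

lemma equiv_connectivity: "equiv V (connectivity V E)"
  unfolding connectivity_def
  by (rule equivI)
     (auto simp: refl_on_def intro!: symI transI dest: symD[OF sym_rtrancl[OF sym_adjacency]])

lemma edges_within_finite: "finite V \<Longrightarrow> edges_within V E \<Longrightarrow> finite E"
  by (rule finite_subset[of _ "Pow V"]) (auto simp: edges_within_def)

lemma edges_within_mono: "edges_within V E \<Longrightarrow> V \<subseteq> V' \<Longrightarrow> edges_within V' E"
  by (fastforce simp: edges_within_def)

lemma edges_within_insert:
  "edges_within V E \<Longrightarrow> a \<in> V \<Longrightarrow> b \<in> V \<Longrightarrow> edges_within V (insert {a, b} E)"
  unfolding edges_within_def by blast

lemma edges_within_induced:
  "edges_within UNIV E \<Longrightarrow> edges_within V (induced_edges E V)"
  unfolding edges_within_def induced_edges_def by fastforce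

lemma rtrancl_adjacency_within:
  assumes "edges_within V E" "(x, y) \<in> (adjacency E)\<^sup>*"
  shows "x = y \<or> x \<in> V \<and> y \<in> V"
  using assms(2)
proof induction
  case (step y z)
  then show ?case
    using assms(1) by (fastforce simp: edges_within_def doubleton_eq_iff)
qed simp

lemma first_betti_empty: "first_betti {} {} = 0"
  by (simp add: first_betti_def graph_components_def)

lemma first_betti_new_vertex:
  assumes "finite V" "edges_within V E" "x \<notin> V"
  shows "first_betti (insert x V) E = first_betti V E"
proof -
  have conn: "connectivity (insert x V) E = insert (x, x) (connectivity V E)"
    using rtrancl_adjacency_within[OF assms(2)] assms(3) by (auto simp: connectivity_def)
  have nox: "connectivity V E `` {x} = {}"
    using assms(3) by (auto simp: connectivity_def)
  have "connectivity (insert x V) E `` {x} = {x}"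
    using nox conn by auto
  moreover have "connectivity (insert x V) E `` {y} = connectivity V E `` {y}" if "y \<in> V" for y
    using that conn assms(3) by auto
  ultimately have "graph_components (insert x V) E = insert {x} (graph_components V E)"
    by (simp add: graph_components_eq quotient_def)
  moreover have "{x} \<notin> graph_components V E"
    using assms(3) by (auto simp: graph_components_eq quotient_def connectivity_def)
  moreover have "finite (graph_components V E)"
    using assms(1) by (simp add: graph_components_eq quotient_def)
  ultimately show ?thesis
    using assms(1,3) by (simp add: first_betti_def)
qed

lemma connectivity_insert_edge:
  assumes "a \<in> V" "b \<in> V"
  shows "(x, y) \<in> connectivity V (insert {a, b} E) \<longleftrightarrow>
    (x, y) \<in> connectivity V E \<or>
    (x, a) \<in> connectivity V E \<and> (b, y) \<in> connectivity V E \<or>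
    (x, b) \<in> connectivity V E \<and> (a, y) \<in> connectivity V E"
proof -
  have "adjacency (insert {a, b} E) = insert (a, b) (insert (b, a) (adjacency E))"
    by (auto simp: doubleton_eq_iff)
  then show ?thesis
    using assms unfolding connectivity_def
    by (auto simp: rtrancl_insert intro: rtrancl_trans)
qed

text \<open>
  A new edge joins at most two components. So the class of \<open>a\<close> is the only component that can be lost,
  and this is shown by an injection from the other old components to the new ones.
\<close>

lemma first_betti_insert_edge:
  assumes "finite V" "edges_within V E" "a \<in> V" "b \<in> V" "{a, b} \<notin> E"
  shows "first_betti V E \<le> first_betti V (insert {a, b} E)"
    and "(a, b) \<in> connectivity V E \<Longrightarrow>
           first_betti V (insert {a, b} E) = first_betti V E + 1"
proof -
  let ?R = "connectivity V E" and ?R' = "connectivity V (insert {a, b} E)"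
  have eq: "equiv V ?R" and eq': "equiv V ?R'"
    by (rule equiv_connectivity)+
  have fin: "finite (V // ?R)" "finite (V // ?R')"
    using assms(1) by (simp_all add: quotient_def)
  have cardE: "card (insert {a, b} E) = card E + 1"
    using assms edges_within_finite[OF assms(1,2)] by simp
  have sub: "?R \<subseteq> ?R'"
    using connectivity_insert_edge[OF assms(3,4)] by auto
  have "inj_on (\<lambda>C. ?R' `` C) (V // ?R - {?R `` {a}})"
  proof (rule inj_onI)
    fix C D
    assume C: "C \<in> V // ?R - {?R `` {a}}" and D: "D \<in> V // ?R - {?R `` {a}}"
      and same: "?R' `` C = ?R' `` D"
    obtain x where x: "x \<in> V" "C = ?R `` {x}"
      using C by (auto elim: quotientE)
    obtain y where y: "y \<in> V" "D = ?R `` {y}"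
      using D by (auto elim: quotientE)
    have "(x, a) \<notin> ?R" "(y, a) \<notin> ?R"
      using C D x y equiv_class_eq[OF eq] by auto
    moreover have "x \<in> ?R' `` C"
      using x eq eq' by (auto simp: Image_def equiv_def refl_on_def)
    then have "x \<in> ?R' `` D"
      using same by simp
    then obtain z where "(y, z) \<in> ?R" "(z, x) \<in> ?R'"
      using y by auto
    then have "(y, x) \<in> ?R'"
      using sub eq' by (meson equiv_def subsetD transE)
    moreover have "sym ?R"
      using eq by (simp add: equiv_def)
    ultimately have "(y, x) \<in> ?R"
      using connectivity_insert_edge[OF assms(3,4)] by (meson symE)
    then show "C = D"
      using x y equiv_class_eq[OF eq] by auto
  qed
  moreover have "(\<lambda>C. ?R' `` C) ` (V // ?R - {?R `` {a}}) \<subseteq> V // ?R'"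
  proof (rule image_subsetI)
    fix C
    assume "C \<in> V // ?R - {?R `` {a}}"
    then obtain x where x: "x \<in> V" "C = ?R `` {x}"
      by (auto elim: quotientE)
    have "x \<in> C"
      using x equiv_class_self[OF eq] by simp
    moreover have "(x, y) \<in> ?R'" if "z \<in> C" "(z, y) \<in> ?R'" for y z
    proof -
      have "(x, z) \<in> ?R'"
        using that x sub by auto
      then show ?thesis
        using that eq' by (meson equiv_def transD)
    qed
    ultimately have "?R' `` C = ?R' `` {x}"
      unfolding Image_def by fast
    then show "?R' `` C \<in> V // ?R'"
      using x by (simp add: quotientI)
  qed
  ultimately have "card (V // ?R - {?R `` {a}}) \<le> card (V // ?R')"
    using fin by (simp add: card_inj_on_le)
  moreover have "?R `` {a} \<in> V // ?R"
    using assms(3) by (rule quotientI)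
  ultimately have "card (V // ?R) \<le> card (V // ?R') + 1"
    using fin by (simp add: card_Diff_singleton)
  then show "first_betti V E \<le> first_betti V (insert {a, b} E)"
    using cardE by (simp add: first_betti_def graph_components_eq)
  assume ab: "(a, b) \<in> ?R"
  have "?R' = ?R"
  proof (rule subset_antisym[OF subrelI sub])
    fix x y
    assume "(x, y) \<in> ?R'"
    then show "(x, y) \<in> ?R"
      using connectivity_insert_edge[OF assms(3,4), of x y] ab eq unfolding equiv_def
      by (meson symE transE)
  qed
  then show "first_betti V (insert {a, b} E) = first_betti V E + 1"
    using cardE by (simp add: first_betti_def graph_components_eq)
qed

lemma first_betti_mono_edges:
  assumes "finite V" "edges_within V E'" "E \<subseteq> E'"
  shows "first_betti V E \<le> first_betti V E'"
proof -
  have "finite F \<Longrightarrow> edges_within V (E \<union> F) \<Longrightarrow> first_betti V E \<le> first_betti V (E \<union> F)" for F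
  proof (induction F rule: finite_induct)
    case (insert e F)
    then have w: "edges_within V (E \<union> F)"
      by (auto simp: edges_within_def)
    then have IH: "first_betti V E \<le> first_betti V (E \<union> F)"
      using insert by simp
    obtain a b where ab: "a \<in> V" "b \<in> V" "e = {a, b}"
      using insert.prems by (auto simp: edges_within_def)
    show ?case
    proof (cases "e \<in> E \<union> F")
      case True
      then show ?thesis using IH by (simp add: insert_absorb)
    next
      case False
      then have "first_betti V (E \<union> F) \<le> first_betti V (insert e (E \<union> F))"
        using first_betti_insert_edge(1)[OF assms(1) w ab(1,2)] ab(3) by simp
      then show ?thesis using IH by simp
    qed
  qed simp
  from this[of E'] show ?thesis
    using assms edges_within_finite by (auto simp: Un_absorb1)
qed

text \<open>
  Isolated vertices do not change the Betti number, hence the vertex set is enlarged first and the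
  edges are then added one at a time.
\<close>

lemma first_betti_mono:
  assumes "finite V'" "edges_within V E" "edges_within V' E'" "V \<subseteq> V'" "E \<subseteq> E'"
  shows "first_betti V E \<le> first_betti V' E'"
proof -
  have "finite U \<Longrightarrow> first_betti (V \<union> U) E = first_betti V E" for U
  proof (induction U rule: finite_induct)
    case (insert x U)
    have fin: "finite (V \<union> U)" and w: "edges_within (V \<union> U) E"
      using insert.hyps finite_subset[OF assms(4,1)] edges_within_mono[OF assms(2)] by auto
    show ?case
      using insert.IH first_betti_new_vertex[OF fin w, of x]
      by (cases "x \<in> V \<union> U") (auto simp: insert_absorb)
  qed simp
  from this[OF assms(1)] have "first_betti V E = first_betti V' E"
    using assms(4) by (simp add: Un_absorb1)
  then show ?thesis
    using first_betti_mono_edges[OF assms(1,3,5)] by simp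
qed

lemma first_betti_nonneg: "finite V \<Longrightarrow> edges_within V E \<Longrightarrow> 0 \<le> first_betti V E"
  using first_betti_mono[of V "{}" "{}" E] by (simp add: first_betti_empty edges_within_def)

text \<open>
  The edge from \<open>u\<close> to \<open>x\<close> connects \<open>x\<close> to the component that contains \<open>v\<close>, and the edge from \<open>v\<close> to \<open>x\<close> then
  closes a cycle.
\<close>

lemma first_betti_new_cycle:
  assumes "finite V" "edges_within V E" "x \<notin> V" "(u, v) \<in> connectivity V E" "u \<noteq> v"
    and "edges_within (insert x V) E'" "E \<subseteq> E'" "{u, x} \<in> E'" "{v, x} \<in> E'"
  shows "first_betti V E + 1 \<le> first_betti (insert x V) E'"
proof -
  let ?V = "insert x V"
  have uv: "u \<in> V" "v \<in> V"
    using assms(4) by (auto simp: connectivity_def)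
  have fin: "finite ?V" and w: "edges_within ?V E"
    using assms(1) edges_within_mono[OF assms(2)] by auto
  have w1: "edges_within ?V (insert {u, x} E)"
    using w uv by (simp add: edges_within_insert)
  have sub: "insert {v, x} (insert {u, x} E) \<subseteq> E'"
    using assms(7-9) by simp
  have new: "{u, x} \<notin> E" "{v, x} \<notin> insert {u, x} E"
    using assms(2,3,5) uv by (auto simp: edges_within_def doubleton_eq_iff)
  have "(v, u) \<in> connectivity V E"
    using assms(4) equiv_connectivity[of V E] by (meson equiv_def symE)
  then have "(v, u) \<in> connectivity ?V E"
    by (auto simp: connectivity_def)
  moreover have "(x, x) \<in> connectivity ?V E"
    by (simp add: connectivity_def)
  ultimately have "(v, x) \<in> connectivity ?V (insert {u, x} E)"
    using connectivity_insert_edge[of u ?V x] uv by blast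
  then have "first_betti ?V (insert {v, x} (insert {u, x} E)) =
      first_betti ?V (insert {u, x} E) + 1"
    using first_betti_insert_edge(2)[OF fin w1, of v x] uv new by simp
  moreover have "first_betti ?V E \<le> first_betti ?V (insert {u, x} E)"
    using first_betti_insert_edge(1)[OF fin w, of u x] uv new by simp
  ultimately show ?thesis
    using first_betti_mono_edges[OF fin assms(6) sub] first_betti_new_vertex[OF assms(1,2,3)]
    by simp
qed

section \<open>Normals and mirrors of a polytope\<close>

text \<open>
  The polytope may have smaller dimension than the ambient space, so the normal of a supporting
  hyperplane is projected to the direction space of the affine hull. With this normal the reflection in
  the facet is given by the usual formula on the affine hull.
\<close>

lemma facet_unit_normal:
  fixes P :: "'e::euclidean_space set"
  assumes "polytope P" "F facet_of P"
  obtains n a where "norm n = 1"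
    and "\<And>x c. x \<in> affine hull P \<Longrightarrow> x + c *\<^sub>R n \<in> affine hull P"
    and "P \<subseteq> {x. n \<bullet> x \<le> a}" "F = P \<inter> {x. n \<bullet> x = a}"
    and "\<And>x. x \<in> affine hull P \<Longrightarrow> face_reflection F x = x - (2 * (n \<bullet> x - a)) *\<^sub>R n"
proof -
  obtain a0 b0 where P0: "P \<subseteq> {x. a0 \<bullet> x \<le> b0}" and F0: "F = P \<inter> {x. a0 \<bullet> x = b0}"
    using facet_of_polyhedron[OF polytope_imp_polyhedron[OF assms(1)] assms(2)] by metis
  have F: "F \<noteq> {}" "F \<subseteq> P" "F \<noteq> P" "aff_dim F = aff_dim P - 1"
    using assms(2) by (auto simp: facet_of_def face_of_def)
  then obtain q where q: "q \<in> P"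
    by blast
  define V where "V = affine hull P"
  have V: "affine V" "q \<in> V" "P \<subseteq> V"
    using q by (auto simp: V_def hull_inc hull_subset)
  let ?L = "(\<lambda>x. x - q) ` V"
  have L: "subspace ?L"
    using V by (simp add: affine_diffs_subspace_subtract)
  obtain n0 z where n0: "n0 \<in> ?L" and z: "\<And>w. w \<in> ?L \<Longrightarrow> z \<bullet> w = 0" and dec: "a0 = n0 + z"
    using orthogonal_subspace_decomp_exists[of ?L a0] L
    by (metis orthogonal_def span_eq_iff)
  define b' where "b' = b0 - a0 \<bullet> q + n0 \<bullet> q"
  have a0: "a0 \<bullet> x - b0 = n0 \<bullet> x - b'" if "x \<in> V" for x
    using z[of "x - q"] that by (simp add: b'_def dec inner_simps)
  have "n0 \<noteq> 0"
  proof
    assume "n0 = 0"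
    obtain y where y: "y \<in> F"
      using F by blast
    then have "b' = 0"
      using a0[of y] F0 V \<open>n0 = 0\<close> by auto
    then have "F = P"
      using F0 a0 V \<open>n0 = 0\<close> by force
    then show False using F by simp
  qed
  define n where "n = n0 /\<^sub>R norm n0"
  define a where "a = b' / norm n0"
  have n: "norm n = 1"
    using \<open>n0 \<noteq> 0\<close> by (simp add: n_def)
  then have nn: "n \<bullet> n = 1"
    by (simp add: dot_square_norm)
  have na: "n \<bullet> x - a = (a0 \<bullet> x - b0) / norm n0" if "x \<in> V" for x
    unfolding a0[OF that] by (simp add: n_def a_def divide_inverse algebra_simps)
  have P: "P \<subseteq> {x. n \<bullet> x \<le> a}"
  proof clarify
    fix x
    assume "x \<in> P"
    then have "n \<bullet> x - a \<le> 0"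
      using na[of x] P0 V(3) by (auto simp: divide_le_0_iff subset_iff simp del: diff_le_0_iff_le)
    then show "n \<bullet> x \<le> a" by simp
  qed
  have "n \<bullet> x = a \<longleftrightarrow> a0 \<bullet> x = b0" if "x \<in> P" for x
    using na[of x] V that \<open>n0 \<noteq> 0\<close> by auto
  then have Feq: "F = P \<inter> {x. n \<bullet> x = a}"
    using F0 by auto
  have "n \<in> ?L"
    using n0 L by (simp add: n_def subspace_scale)
  then have dir: "x + c *\<^sub>R n \<in> V" if "x \<in> V" for x c
    using mem_affine_3_minus[OF V(1) that, of "n + q" q c] V by auto
  let ?H = "V \<inter> {x. n \<bullet> x = a}"
  have H: "affine hull F = ?H"
  proof (rule affine_dim_equal)
    show "affine hull F \<subseteq> ?H"
      using V Feq by (intro hull_minimal affine_Int affine_hyperplane) auto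
    have "\<not> V \<subseteq> {x. n \<bullet> x = a}"
      using F V Feq by blast
    moreover have "?H \<noteq> {}"
      using F V Feq by blast
    ultimately show "aff_dim (affine hull F) = aff_dim ?H"
      using aff_dim_affine_Int_hyperplane[OF V(1), of n a] F by (simp add: V_def)
  qed (use V F in \<open>auto intro!: affine_Int affine_hyperplane\<close>)
  have "face_reflection F x = x - (2 * (n \<bullet> x - a)) *\<^sub>R n" if x: "x \<in> V" for x
  proof -
    let ?y = "x - (n \<bullet> x - a) *\<^sub>R n"
    have "?y = closest_point ?H x"
    proof (rule closest_point_unique)
      show "convex ?H" "closed ?H"
        by (simp_all flip: H)
      show "?y \<in> ?H"
        using dir[OF x, of "a - n \<bullet> x"] nn by (simp add: algebra_simps inner_diff_right)
      show "\<forall>w\<in>?H. dist x ?y \<le> dist x w"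
      proof
        fix w
        assume "w \<in> ?H"
        then have "n \<bullet> x - a = n \<bullet> (x - w)"
          by (simp add: inner_diff_right)
        then have "\<bar>n \<bullet> x - a\<bar> \<le> norm n * norm (x - w)"
          by (simp add: Cauchy_Schwarz_ineq2)
        then show "dist x ?y \<le> dist x w"
          using n by (simp add: dist_norm)
      qed
    qed
    moreover have "2 *\<^sub>R (x - c *\<^sub>R n) - x = x - (2 * c) *\<^sub>R n" for c
      by (simp add: scaleR_right_diff_distrib scaleR_2)
    ultimately show ?thesis
      unfolding face_reflection_def H by metis
  qed
  then show thesis
    using that[OF n _ P Feq] dir by (simp add: V_def)
qed

text \<open>
  In a linear dependence between vectors with nonpositive inner products, the positive part and the
  negative part each have to vanish, so only dependences with nonnegative coefficients matter. The
  support of such a dependence is orthogonal to all remaining vectors, and irreducibility forces it to be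
  empty unless it is everything. Hence a proper subset of the normals is linearly independent, and any
  values \<open>a i\<close> can be prescribed.
\<close>

lemma common_point_of_hyperplanes:
  fixes V :: "'e::euclidean_space set" and n :: "'i \<Rightarrow> 'e"
  assumes "affine V" "V \<noteq> {}"
    and dir: "\<And>i x. i \<in> A \<Longrightarrow> x \<in> V \<Longrightarrow> x + n i \<in> V"
    and norm: "\<And>i. i \<in> A \<Longrightarrow> norm (n i) = 1"
    and nonpos: "\<And>i j. i \<in> A \<Longrightarrow> j \<in> A \<Longrightarrow> i \<noteq> j \<Longrightarrow> n i \<bullet> n j \<le> 0"
    and irred: "\<And>I. I \<subseteq> A \<Longrightarrow> I \<noteq> {} \<Longrightarrow> I \<noteq> A \<Longrightarrow> \<exists>i\<in>I. \<exists>j\<in>A - I. n i \<bullet> n j \<noteq> 0"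
    and "finite A" "E \<subset> A"
  shows "\<exists>p\<in>V. \<forall>i\<in>E. n i \<bullet> p = a i"
proof -
  have finE: "finite E" and EA: "E \<subseteq> A"
    using assms(7,8) finite_subset by auto
  have pos: "\<forall>i\<in>E. c i = 0" if c: "\<And>i. i \<in> E \<Longrightarrow> 0 \<le> c i" and zero: "(\<Sum>i\<in>E. c i *\<^sub>R n i) = 0" for c
  proof (rule ccontr)
    let ?I = "{i \<in> E. c i \<noteq> 0}"
    assume "\<not> (\<forall>i\<in>E. c i = 0)"
    then obtain i j where i: "i \<in> ?I" and j: "j \<in> A - ?I" and ij: "n i \<bullet> n j \<noteq> 0"
      using irred[of ?I] assms(8) by blast
    have "(\<Sum>i\<in>E. c i * (n i \<bullet> n j)) = (\<Sum>i\<in>E. c i *\<^sub>R n i) \<bullet> n j"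
      by (simp add: inner_sum_left)
    also have "\<dots> = 0"
      by (simp add: zero)
    finally have "(\<Sum>i\<in>E. c i * (n i \<bullet> n j)) = 0" .
    moreover have "c k * (n k \<bullet> n j) \<le> 0" if "k \<in> E" for k
    proof (cases "k = j")
      case False
      then show ?thesis
        using c[OF that] nonpos[of k j] that j EA by (auto intro: mult_nonneg_nonpos)
    qed (use that j in auto)
    ultimately have "\<forall>k\<in>E. c k * (n k \<bullet> n j) = 0"
      using sum_nonneg_eq_0_iff[OF finE, of "\<lambda>k. - (c k * (n k \<bullet> n j))"]
      by (simp add: sum_negf)
    then show False
      using i ij by auto
  qed
  have indep: "\<forall>i\<in>E. u i = 0" if zero: "(\<Sum>i\<in>E. u i *\<^sub>R n i) = 0" for u
  proof -
    define v where "v = (\<Sum>i\<in>E. max (u i) 0 *\<^sub>R n i)"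
    have "v - (\<Sum>i\<in>E. max (- u i) 0 *\<^sub>R n i) = (\<Sum>i\<in>E. u i *\<^sub>R n i)"
      unfolding v_def sum_subtractf[symmetric]
      by (intro sum.cong refl) (simp add: max_def flip: scaleR_left_diff_distrib)
    then have v: "v = (\<Sum>i\<in>E. max (- u i) 0 *\<^sub>R n i)"
      using zero by simp
    have "v \<bullet> v = (\<Sum>i\<in>E. \<Sum>j\<in>E. max (u i) 0 * (max (- u j) 0 * (n i \<bullet> n j)))"
    proof -
      have "v \<bullet> v = (\<Sum>i\<in>E. max (u i) 0 *\<^sub>R n i) \<bullet> (\<Sum>j\<in>E. max (- u j) 0 *\<^sub>R n j)"
        using v by (simp flip: v_def)
      then show ?thesis
        by (simp add: inner_sum_left) (simp add: inner_sum_right sum_distrib_left)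
    qed
    also have "\<dots> \<le> 0"
    proof (intro sum_nonpos)
      fix i j
      assume "i \<in> E" "j \<in> E"
      then show "max (u i) 0 * (max (- u j) 0 * (n i \<bullet> n j)) \<le> 0"
        using nonpos[of i j] EA
        by (cases "i = j") (simp add: max_def, intro mult_nonneg_nonpos, auto)
    qed
    finally have "v = 0"
      by (meson inner_gt_zero_iff linorder_not_le)
    then have sums: "(\<Sum>i\<in>E. max (u i) 0 *\<^sub>R n i) = 0" "(\<Sum>i\<in>E. max (- u i) 0 *\<^sub>R n i) = 0"
      using v by (simp_all flip: v_def)
    have "\<forall>i\<in>E. max (u i) 0 = 0" "\<forall>i\<in>E. max (- u i) 0 = 0"
      by (rule pos[OF max.cobounded2 sums(1)], rule pos[OF max.cobounded2 sums(2)])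
    then have "u i \<le> 0 \<and> 0 \<le> u i" if "i \<in> E" for i
      using that max.cobounded1[of "u i" 0] max.cobounded1[of "- u i" 0] by (metis neg_le_0_iff_le)
    then show ?thesis
      by (simp add: order_antisym)
  qed
  have inj: "inj_on n E"
  proof (rule inj_onI, rule ccontr)
    fix i j
    assume "i \<in> E" "j \<in> E" "n i = n j" "i \<noteq> j"
    then show False
      using nonpos[of i j] norm[of j] EA by (auto simp: dot_square_norm)
  qed
  have "independent (n ` E)"
  proof
    assume "dependent (n ` E)"
    then obtain u where u: "\<exists>v\<in>n ` E. u v \<noteq> 0" "(\<Sum>v\<in>n ` E. u v *\<^sub>R v) = 0"
      using finE by (auto simp: dependent_finite)
    then show False
      using indep[of "\<lambda>i. u (n i)"] inj by (auto simp: sum.reindex)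
  qed
  obtain q where q: "q \<in> V"
    using assms(2) by blast
  obtain g :: "'e \<Rightarrow> real" where g: "linear g"
    and "\<forall>x\<in>n ` E. g x = a (inv_into E n x) - x \<bullet> q"
    using linear_independent_extend[OF \<open>independent (n ` E)\<close>,
        of "\<lambda>x. a (inv_into E n x) - x \<bullet> q"] by metis
  then have gn: "g (n i) = a i - n i \<bullet> q" if "i \<in> E" for i
    using that inj by simp
  let ?L = "(\<lambda>x. x - q) ` V"
  have L: "subspace ?L"
    using assms(1) q by (simp add: affine_diffs_subspace_subtract)
  \<comment> \<open>The functional \<open>g\<close> is represented by a vector, whose projection to the
    direction space of \<open>V\<close> takes the same values on the normals.\<close>
  obtain w z where w: "w \<in> ?L" and z: "\<And>x. x \<in> ?L \<Longrightarrow> z \<bullet> x = 0"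
    and dec: "adjoint g 1 = w + z"
    using orthogonal_subspace_decomp_exists[of ?L "adjoint g 1"] L
    by (metis orthogonal_def span_eq_iff)
  have "n i \<bullet> (q + w) = a i" if "i \<in> E" for i
  proof -
    have "q + n i \<in> V"
      using dir[of i q] that q EA by auto
    then have "n i \<in> ?L"
      by (metis add_diff_cancel_left' imageI)
    then have "z \<bullet> n i = 0"
      by (rule z)
    moreover have "n i \<bullet> (w + z) = g (n i)"
      using adjoint_works[OF g, of "n i" 1] dec by simp
    ultimately have "n i \<bullet> w = g (n i)"
      by (simp add: inner_add_right inner_commute)
    then show ?thesis
      using gn[OF that] by (simp add: inner_add_right)
  qed
  moreover have "q + w \<in> V"
    using w by auto
  ultimately show ?thesis
    by blast
qed

section \<open>Irreducible affine subsets\<close>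

text \<open>
  Coxeter generators are viewed here as a finite family of involutions in a group. The Coxeter
  relations reappear in \<open>noncommuting_dynkin_edge\<close>, which relates commutation to the Dynkin diagram.
\<close>

locale involution_family = group W for W (structure) +
  fixes \<sigma> :: "'s::finite \<Rightarrow> 'a"
  assumes \<sigma>_closed: "\<sigma> s \<in> carrier W"
    and \<sigma>_involution: "\<sigma> s \<otimes> \<sigma> s = \<one>"
begin

abbreviation nonspherical :: "'s set \<Rightarrow> bool" where
  "nonspherical T \<equiv> \<not> spherical W \<sigma> T"

lemma carrier_special: "carrier (special_subgroup W \<sigma> T) = generate W (\<sigma> ` T)"
proof -
  have "carrier W \<inter> \<sigma> ` T = \<sigma> ` T"
    using \<sigma>_closed by auto
  then show ?thesis
    by (simp add: special_subgroup_def carrier_subgroup_generated)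
qed

lemma inv_\<sigma>: "inv (\<sigma> s) = \<sigma> s"
  by (simp add: \<sigma>_closed \<sigma>_involution inv_equality)

text \<open>
  Since translates of the open chamber by distinct group elements are disjoint, no mirror of a reflection in the
  group meets the open chamber. Applied to the image of one wall under the reflection in another, this rules out
  acute angles between outer normals. A proper subset of the walls then has a common point \<open>p\<close>. The
  group generated by the corresponding reflections preserves the distance to \<open>p\<close>, and the images of
  an interior point of the chamber are uniformly separated, so there are only finitely many of them.
  The whole group is infinite, as finitely many translates of a bounded set cannot cover an affine space of
  positive dimension.
\<close>

lemma affine_irreducible_minimal:
  assumes "affine_subset W \<sigma> A" "irreducible_subset W \<sigma> A" "A \<noteq> {}"
  shows "minimal_nonspherical W \<sigma> A"
proof -
  obtain P :: "(real ^ 's) set" and F \<phi> where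
    P: "polytope P" "P \<noteq> {}" and bij: "bij_betw F A {G. G facet_of P}"
    and faith: "faithful_action (special_subgroup W \<sigma> A) (affine hull P) \<phi>"
    and refl: "\<And>t x. t \<in> A \<Longrightarrow> x \<in> affine hull P \<Longrightarrow> \<phi> (\<sigma> t) x = face_reflection (F t) x"
    and cover: "(\<Union>g\<in>carrier (special_subgroup W \<sigma> A). \<phi> g ` P) = affine hull P"
    and tile: "\<And>g. g \<in> carrier (special_subgroup W \<sigma> A) \<Longrightarrow> g \<noteq> \<one> \<Longrightarrow>
        rel_interior P \<inter> \<phi> g ` rel_interior P = {}"
    using assms(1) unfolding affine_subset_def by metis
  define V where "V = affine hull P"
  define G where "G = generate W (\<sigma> ` A)"
  interpret act: faithful_action "special_subgroup W \<sigma> A" V \<phi>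
    using faith by (simp add: V_def)
  have GW: "g \<in> carrier W" if "g \<in> G" for g
    using that generate_in_carrier[of "\<sigma> ` A" g] \<sigma>_closed by (auto simp: G_def)
  have \<sigma>G: "\<sigma> t \<in> G" if "t \<in> A" for t
    using that by (simp add: G_def generate.incl)
  have multG: "g \<otimes> h \<in> G" if "g \<in> G" "h \<in> G" for g h
    using that by (simp add: G_def generate.eng)
  have invG: "inv g \<in> G" if "g \<in> G" for g
    using that generate_m_inv_closed[of "\<sigma> ` A"] \<sigma>_closed by (auto simp: G_def)
  have comp: "\<phi> (g \<otimes> h) x = \<phi> g (\<phi> h x)" if "g \<in> G" "h \<in> G" "x \<in> V" for g h x
    using act.composition_rule[of x g h] that unfolding carrier_special G_def
    by (simp add: special_subgroup_def)
  have actone: "\<phi> \<one> x = x" if "x \<in> V" for x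
    using act.id_eq_one that by (metis one_subgroup_generated restrict_apply' special_subgroup_def)
  have actV: "\<phi> g x \<in> V" if "g \<in> G" "x \<in> V" for g x
    using act.element_image[of g x "\<phi> g x"] that by (simp add: carrier_special G_def)
  have ext: "g = h" if "g \<in> G" "h \<in> G" "\<And>x. x \<in> V \<Longrightarrow> \<phi> g x = \<phi> h x" for g h
  proof -
    have "\<phi> g = \<phi> h"
      using that act.bij_prop0[of g] act.bij_prop0[of h]
      by (auto simp: carrier_special G_def Bij_def intro: extensionalityI)
    then show ?thesis
      using act.faithful that by (auto simp: carrier_special G_def dest: inj_onD)
  qed
  have facet: "F t facet_of P" if "t \<in> A" for t
    using bij that by (auto simp: bij_betw_def)
  define normal where "normal t n a \<longleftrightarrow> norm n = 1 \<and> (\<forall>x\<in>V. \<forall>c. x + c *\<^sub>R n \<in> V) \<and>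
      P \<subseteq> {x. n \<bullet> x \<le> a} \<and> F t = P \<inter> {x. n \<bullet> x = a} \<and>
      (\<forall>x\<in>V. face_reflection (F t) x = x - (2 * (n \<bullet> x - a)) *\<^sub>R n)" for t n a
  have "\<exists>n a. normal t n a" if t: "t \<in> A" for t
  proof -
    obtain n a where "norm n = 1"
      and "\<And>x c. x \<in> V \<Longrightarrow> x + c *\<^sub>R n \<in> V"
      and "P \<subseteq> {x. n \<bullet> x \<le> a}" "F t = P \<inter> {x. n \<bullet> x = a}"
      and "\<And>x. x \<in> V \<Longrightarrow> face_reflection (F t) x = x - (2 * (n \<bullet> x - a)) *\<^sub>R n"
      by (rule facet_unit_normal[OF P(1) facet[OF t], folded V_def]) blast
    then have "normal t n a"
      unfolding normal_def by blast
    then show ?thesis by blast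
  qed
  then obtain n a where na: "\<And>t. t \<in> A \<Longrightarrow> normal t (n t) (a t)"
    by metis
  have norm: "norm (n t) = 1" and Fn: "F t = P \<inter> {x. n t \<bullet> x = a t}" if "t \<in> A" for t
    using na[OF that] by (simp_all add: normal_def)
  have dir: "x + c *\<^sub>R n t \<in> V" if "t \<in> A" "x \<in> V" for t x c
    using na[OF that(1)] that(2) by (simp add: normal_def)
  have Pn: "n t \<bullet> x \<le> a t" if "t \<in> A" "x \<in> P" for t x
    using na[OF that(1)] that(2) by (auto simp: normal_def)
  have s: "\<phi> (\<sigma> t) x = x - (2 * (n t \<bullet> x - a t)) *\<^sub>R n t" if "t \<in> A" "x \<in> V" for t x
  proof -
    have "face_reflection (F t) x = x - (2 * (n t \<bullet> x - a t)) *\<^sub>R n t"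
      using na[OF that(1)] that(2) unfolding normal_def by blast
    then show ?thesis
      using refl[of t x] that by (simp add: V_def)
  qed
  have nn: "n t \<bullet> n t = 1" if "t \<in> A" for t
    using norm[OF that] by (simp add: dot_square_norm)
  have V: "affine V" "P \<subseteq> V"
    by (auto simp: V_def hull_subset)
  have refl_iso: "dist (\<phi> (\<sigma> t) x) (\<phi> (\<sigma> t) y) = dist x y" if "t \<in> A" "x \<in> V" "y \<in> V" for t x y
  proof -
    let ?w = "x - y"
    have "\<phi> (\<sigma> t) x - \<phi> (\<sigma> t) y = ?w - (2 * (n t \<bullet> ?w)) *\<^sub>R n t"
      using that by (simp add: s algebra_simps inner_diff_right)
    moreover have "norm (?w - (2 * (n t \<bullet> ?w)) *\<^sub>R n t) = norm ?w"
      unfolding norm_eq using nn[OF that(1)]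
      by (simp add: inner_diff_left inner_diff_right inner_commute algebra_simps)
    ultimately show ?thesis
      by (simp add: dist_norm)
  qed
  have iso: "\<forall>x\<in>V. \<forall>y\<in>V. dist (\<phi> g x) (\<phi> g y) = dist x y" if "g \<in> G" for g
    using that unfolding G_def
  proof (induction g rule: generate.induct)
    case one
    then show ?case using actone by simp
  next
    case (incl g)
    then show ?case using refl_iso by auto
  next
    case (inv g)
    then show ?case using refl_iso inv_\<sigma> by auto
  next
    case (eng g h)
    then have "g \<in> G" "h \<in> G"
      by (simp_all add: G_def)
    then show ?case
      using eng.IH comp actV by simp
  qed
  have relP: "rel_interior P \<noteq> {}" "rel_interior P \<subseteq> P" "convex (rel_interior P)"
    "closure (rel_interior P) = P"
    using P polytope_imp_convex[OF P(1)] polytope_imp_closed[OF P(1)]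
    by (simp_all add: rel_interior_eq_empty convex_rel_interior convex_closure_rel_interior
        rel_interior_subset)
  obtain q where q: "q \<in> rel_interior P"
    using relP by blast
  have qV: "q \<in> V"
    using q relP V by blast
  have distinct: "\<not> F i \<subseteq> F j" if "i \<in> A" "j \<in> A" "i \<noteq> j" for i j
  proof
    assume sub: "F i \<subseteq> F j"
    have "F i face_of F j"
      using facet that sub
      by (meson face_of_subset facet_of_imp_face_of facet_of_imp_subset)
    moreover have "convex (F j)"
      using facet[OF that(2)] by (meson face_of_imp_convex facet_of_imp_face_of)
    moreover have "aff_dim (F i) = aff_dim (F j)"
      using facet that by (simp add: facet_of_def)
    ultimately have "F i = F j"
      using face_of_aff_dim_lt[of "F j" "F i"] by auto
    then show False
      using bij that by (auto simp: bij_betw_def dest: inj_onD)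
  qed
  have qn: "n t \<bullet> q < a t" if "t \<in> A" for t
  proof (rule ccontr)
    assume "\<not> n t \<bullet> q < a t"
    then have "q \<in> F t"
      using Fn[OF that] Pn[OF that, of q] q relP by auto
    moreover have "F t \<inter> rel_interior P = {}"
      using facet[OF that] by (metis face_of_disjoint_rel_interior facet_of_imp_face_of facet_of_irrefl)
    ultimately show False using q by auto
  qed
  \<comment> \<open>The zero set of \<open>f\<close> below is the mirror of the conjugate of \<open>\<sigma> j\<close> by \<open>\<sigma> i\<close>.\<close>
  have nonpos: "n i \<bullet> n j \<le> 0" if ij: "i \<in> A" "j \<in> A" "i \<noteq> j" for i j
  proof (rule ccontr)
    assume "\<not> n i \<bullet> n j \<le> 0"
    then have c: "0 < n i \<bullet> n j"
      by simp
    define f where "f x = (n j \<bullet> x - a j) - 2 * (n i \<bullet> n j) * (n i \<bullet> x - a i)" for x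
    have fs: "n j \<bullet> \<phi> (\<sigma> i) x - a j = f x" if "x \<in> V" for x
      using that ij by (simp add: s f_def inner_diff_right inner_commute algebra_simps)
    define g where "g = \<sigma> i \<otimes> (\<sigma> j \<otimes> \<sigma> i)"
    have gG: "g \<in> G"
      using \<sigma>G multG ij by (simp add: g_def)
    have \<phi>g: "\<phi> g x = \<phi> (\<sigma> i) (\<phi> (\<sigma> j) (\<phi> (\<sigma> i) x))" if "x \<in> V" for x
      using that ij by (simp add: g_def comp \<sigma>G multG actV)
    have twice: "\<phi> (\<sigma> i) (\<phi> (\<sigma> i) x) = x" if "x \<in> V" for x
      using that ij comp[of "\<sigma> i" "\<sigma> i" x] actone by (simp add: \<sigma>G \<sigma>_involution)
    have "g \<noteq> \<one>"
    proof
      assume "g = \<one>"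
      have "\<phi> (\<sigma> j) x = x" if "x \<in> V" for x
      proof -
        have "\<phi> g (\<phi> (\<sigma> i) x) = \<phi> (\<sigma> i) x"
          using \<open>g = \<one>\<close> actone actV \<sigma>G ij that by simp
        then have "\<phi> (\<sigma> i) (\<phi> (\<sigma> j) x) = \<phi> (\<sigma> i) x"
          using \<phi>g[of "\<phi> (\<sigma> i) x"] actV \<sigma>G ij that twice by simp
        then show ?thesis
          using twice that actV \<sigma>G ij by metis
      qed
      then have "(2 * (n j \<bullet> q - a j)) *\<^sub>R n j = 0"
        using s[of j q] ij qV by simp
      then show False
        using qn[of j] ij norm[of j] by auto
    qed
    have ne: "f x \<noteq> 0" if x: "x \<in> rel_interior P" for x
    proof
      assume "f x = 0"
      have xV: "x \<in> V" using x relP V by blast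
      then have "\<phi> (\<sigma> j) (\<phi> (\<sigma> i) x) = \<phi> (\<sigma> i) x"
        using s[of j "\<phi> (\<sigma> i) x"] fs \<open>f x = 0\<close> actV \<sigma>G ij by simp
      then have "\<phi> g x = x"
        using \<phi>g[OF xV] twice[OF xV] by simp
      then have "x \<in> rel_interior P \<inter> \<phi> g ` rel_interior P"
        using x by force
      moreover have "rel_interior P \<inter> \<phi> g ` rel_interior P = {}"
        using tile[of g] gG \<open>g \<noteq> \<one>\<close> by (simp add: carrier_special G_def)
      ultimately show False
        by blast
    qed
    have cont: "continuous_on UNIV f"
      unfolding f_def by (intro continuous_intros)
    have conn: "connected (f ` rel_interior P)"
      using relP(3) continuous_on_subset[OF cont subset_UNIV]
      by (intro connected_continuous_image convex_connected)
    have "(\<forall>x\<in>rel_interior P. f x \<le> 0) \<or> (\<forall>x\<in>rel_interior P. 0 \<le> f x)"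
    proof (rule ccontr)
      assume "\<not> ?thesis"
      then obtain x y where "x \<in> rel_interior P" "y \<in> rel_interior P" "f y \<le> 0" "0 \<le> f x"
        by force
      then have "0 \<in> f ` rel_interior P"
        using connectedD_interval[OF conn, of "f y" "f x" 0] by blast
      then show False
        using ne by force
    qed
    then consider "\<forall>x\<in>rel_interior P. f x \<le> 0" | "\<forall>x\<in>rel_interior P. 0 \<le> f x"
      by blast
    \<comment> \<open>A positive inner product makes either sign of \<open>f\<close> force one wall into the other.\<close>
    then show False
    proof cases
      case 1
      have "f x \<le> 0" if "x \<in> P" for x
        using continuous_le_on_closure[of "rel_interior P" f x 0] 1 relP(4) that
          continuous_on_subset[OF cont subset_UNIV] by simp
      have "F j \<subseteq> F i"
      proof
        fix x
        assume "x \<in> F j"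
        then have x: "x \<in> P" "n j \<bullet> x = a j"
          using Fn ij by auto
        then have "0 \<le> (n i \<bullet> n j) * (n i \<bullet> x - a i)"
          using \<open>\<And>x. x \<in> P \<Longrightarrow> f x \<le> 0\<close>[of x] by (simp add: f_def)
        then have "a i \<le> n i \<bullet> x"
          using c by (simp add: zero_le_mult_iff)
        then show "x \<in> F i"
          using Fn[of i] Pn[of i x] x ij by auto
      qed
      then show False using distinct ij by blast
    next
      case 2
      have "0 \<le> f x" if "x \<in> P" for x
        using continuous_ge_on_closure[of "rel_interior P" f x 0] 2 relP(4) that
          continuous_on_subset[OF cont subset_UNIV] by simp
      have "F i \<subseteq> F j"
      proof
        fix x
        assume "x \<in> F i"
        then have x: "x \<in> P" "n i \<bullet> x = a i"
          using Fn ij by auto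
        then have "a j \<le> n j \<bullet> x"
          using \<open>\<And>x. x \<in> P \<Longrightarrow> 0 \<le> f x\<close>[of x] by (simp add: f_def)
        then show "x \<in> F j"
          using Fn[of j] Pn[of j x] x ij by auto
      qed
      then show False using distinct ij by blast
    qed
  qed
  have irred: "\<exists>i\<in>I. \<exists>j\<in>A - I. n i \<bullet> n j \<noteq> 0" if I: "I \<subseteq> A" "I \<noteq> {}" "I \<noteq> A" for I
  proof (rule ccontr)
    assume "\<not> ?thesis"
    then have orth: "n i \<bullet> n j = 0" if "i \<in> I" "j \<in> A - I" for i j
      using that by blast
    have "\<sigma> i \<otimes> \<sigma> j = \<sigma> j \<otimes> \<sigma> i" if ij: "i \<in> I" "j \<in> A - I" for i j
    proof (rule ext)
      have A: "i \<in> A" "j \<in> A"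
        using ij I by auto
      show "\<sigma> i \<otimes> \<sigma> j \<in> G" "\<sigma> j \<otimes> \<sigma> i \<in> G"
        using A multG \<sigma>G by auto
      fix x
      assume x: "x \<in> V"
      have "n j \<bullet> n i = 0"
        using orth[OF ij] by (simp add: inner_commute)
      then have "\<phi> (\<sigma> i) (\<phi> (\<sigma> j) x) = \<phi> (\<sigma> j) (\<phi> (\<sigma> i) x)"
        using s[OF A(1) actV[OF \<sigma>G[OF A(2)] x]] s[OF A(2) actV[OF \<sigma>G[OF A(1)] x]]
          s[OF A(1) x] s[OF A(2) x] orth[OF ij] by (simp add: inner_diff_right)
      then show "\<phi> (\<sigma> i \<otimes> \<sigma> j) x = \<phi> (\<sigma> j \<otimes> \<sigma> i) x"
        using A x comp \<sigma>G by simp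
    qed
    then have "disjoint_commuting W \<sigma> I (A - I)"
      by (auto simp: disjoint_commuting_def)
    then show False
      using assms(2) I unfolding irreducible_subset_def by (metis Diff_eq_empty_iff Un_Diff_cancel subset_antisym sup.absorb2)
  qed
  have "spherical W \<sigma> E" if E: "E \<subset> A" for E
  proof -
    define K where "K = generate W (\<sigma> ` E)"
    have KG: "K \<subseteq> G"
      using E unfolding K_def G_def by (intro mono_generate) auto
    have "\<exists>p\<in>V. \<forall>i\<in>E. n i \<bullet> p = a i"
    proof (rule common_point_of_hyperplanes[OF V(1) _ _ norm nonpos irred _ E])
      show "V \<noteq> {}"
        using qV by blast
      show "x + n i \<in> V" if "i \<in> A" "x \<in> V" for i x
        using dir[OF that, of 1] by simp
    qed auto
    then obtain p where p: "p \<in> V" "\<And>i. i \<in> E \<Longrightarrow> n i \<bullet> p = a i"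
      by blast
    have \<sigma>p: "\<phi> (\<sigma> t) p = p" if "t \<in> E" for t
      using s[of t p] p that E by auto
    have fixp: "\<phi> g p = p" if "g \<in> K" for g
      using that unfolding K_def
    proof (induction g rule: generate.induct)
      case (eng g h)
      then have "g \<in> G" "h \<in> G"
        using KG by (auto simp: K_def)
      then show ?case
        using eng.IH comp p by simp
    qed (use actone p \<sigma>p inv_\<sigma> in auto)
    obtain r where r: "r > 0" "ball q r \<inter> V \<subseteq> rel_interior P"
      using q mem_rel_interior_ball[of q "rel_interior P"] P polytope_imp_convex[of P]
      by (auto simp: V_def rel_interior_rel_interior rel_interior_same_affine_hull)
    \<comment> \<open>Images of \<open>q\<close> closer than \<open>r\<close> would make two open chambers overlap.\<close>
    have sep: "g = h" if gh: "g \<in> K" "h \<in> K" "dist (\<phi> g q) (\<phi> h q) < r" for g h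
    proof (rule ccontr)
      assume "g \<noteq> h"
      define k where "k = inv g \<otimes> h"
      have gG: "g \<in> G" "h \<in> G" "k \<in> G"
        using gh KG invG multG unfolding k_def by blast+
      have gk: "g \<otimes> k = h"
        using gG GW by (simp add: k_def inv_solve_left' m_assoc[symmetric])
      then have "k \<noteq> \<one>"
        using \<open>g \<noteq> h\<close> gG GW by auto
      have "dist q (\<phi> k q) = dist (\<phi> g q) (\<phi> g (\<phi> k q))"
        using iso[OF gG(1)] qV actV gG by simp
      also have "\<dots> = dist (\<phi> g q) (\<phi> h q)"
        using comp[of g k q] gk gG qV by simp
      finally have "\<phi> k q \<in> ball q r \<inter> V"
        using gh actV gG qV by simp
      then show False
        using tile[of k] \<open>k \<noteq> \<one>\<close> gG q r by (force simp: carrier_special G_def)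
    qed
    let ?Q = "(\<lambda>g. \<phi> g q) ` K"
    have "uniform_discrete ?Q"
      unfolding uniform_discrete_def using r sep by (intro exI[of _ r]) blast
    moreover have "bounded ?Q"
    proof -
      have "dist p (\<phi> g q) \<le> dist p q" if "g \<in> K" for g
        using iso[of g] fixp[OF that] p qV KG that by (metis order_refl subsetD)
      then show ?thesis
        unfolding bounded_def by blast
    qed
    ultimately have "finite ?Q"
      using uniform_discrete_imp_closed uniform_discrete_imp_discrete discrete_compact_finite_iff
        compact_eq_bounded_closed by metis
    moreover have "inj_on (\<lambda>g. \<phi> g q) K"
      using sep r by (auto intro!: inj_onI)
    ultimately have "finite K"
      by (rule finite_imageD)
    then show ?thesis
      by (simp add: spherical_def carrier_special K_def)
  qed
  moreover have "nonspherical A"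
  proof
    assume "spherical W \<sigma> A"
    then have fin: "finite G"
      by (simp add: spherical_def carrier_special G_def)
    have "bounded (\<phi> g ` P)" if "g \<in> G" for g
    proof -
      have "dist (\<phi> g q) y \<le> diameter P" if y: "y \<in> \<phi> g ` P" for y
      proof -
        obtain z where z: "z \<in> P" "y = \<phi> g z"
          using y by blast
        then have "dist (\<phi> g q) y = dist q z"
          using iso[OF \<open>g \<in> G\<close>] V(2) qV by blast
        also have "\<dots> \<le> diameter P"
          using z(1) q relP(2) polytope_imp_bounded[OF P(1)] by (auto intro: diameter_bounded_bound)
        finally show ?thesis .
      qed
      then show ?thesis
        unfolding bounded_def by blast
    qed
    then have "bounded (\<Union>g\<in>G. \<phi> g ` P)"
      using fin by (intro bounded_UN) auto
    then have "bounded V"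
      using cover by (simp add: V_def carrier_special G_def)
    then have "aff_dim P \<le> 0"
      using affine_bounded_eq_lowdim[OF V(1)] by (simp add: V_def)
    moreover obtain t where "t \<in> A"
      using assms(3) by blast
    then have "F t \<noteq> {}" "aff_dim (F t) = aff_dim P - 1"
      using facet by (auto simp: facet_of_def)
    ultimately show False
      using aff_dim_geq[of "F t"] aff_dim_empty[of "F t"] by auto
  qed
  ultimately show ?thesis
    by (simp add: minimal_nonspherical_def)
qed

section \<open>Minimal nonspherical subsets\<close>

lemma spherical_mono:
  assumes "S \<subseteq> T" "spherical W \<sigma> T"
  shows "spherical W \<sigma> S"
proof -
  have "generate W (\<sigma> ` S) \<subseteq> generate W (\<sigma> ` T)"
    using assms(1) by (intro mono_generate) auto
  then show ?thesis
    using assms(2) finite_subset by (auto simp: spherical_def carrier_special)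
qed

lemma generate_commute:
  assumes "\<And>t. t \<in> T \<Longrightarrow> \<sigma> t \<otimes> c = c \<otimes> \<sigma> t" "c \<in> carrier W" "g \<in> generate W (\<sigma> ` T)"
  shows "g \<otimes> c = c \<otimes> g"
  using assms(3)
proof (induction rule: generate.induct)
  case (eng g h)
  then have "g \<in> carrier W" "h \<in> carrier W"
    using generate_in_carrier[of "\<sigma> ` T"] \<sigma>_closed by auto
  then show ?case
    using eng.IH assms(2) by (metis m_assoc)
qed (use assms(1,2) inv_\<sigma> in auto)

text \<open>
  Every element of the subgroup generated by \<open>A \<union> B\<close> is a product of an element of \<open>\<langle>A\<rangle>\<close> and one of \<open>\<langle>B\<rangle>\<close>.
\<close>

lemma spherical_Un:
  assumes "disjoint_commuting W \<sigma> A B" "spherical W \<sigma> A" "spherical W \<sigma> B"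
  shows "spherical W \<sigma> (A \<union> B)"
proof -
  let ?X = "generate W (\<sigma> ` A)" and ?Y = "generate W (\<sigma> ` B)"
  have carr: "x \<in> carrier W" if "x \<in> generate W (\<sigma> ` T)" for x T
    using that generate_in_carrier[of "\<sigma> ` T"] \<sigma>_closed by auto
  have gen: "\<sigma> b \<otimes> \<sigma> a = \<sigma> a \<otimes> \<sigma> b" if "a \<in> A" "b \<in> B" for a b
    using assms(1) that unfolding disjoint_commuting_def by metis
  have half: "\<sigma> a \<otimes> y = y \<otimes> \<sigma> a" if "a \<in> A" "y \<in> ?Y" for a y
    by (rule generate_commute[OF gen \<sigma>_closed, symmetric]) (use that in blast)+
  have comm: "x \<otimes> y = y \<otimes> x" if "x \<in> ?X" "y \<in> ?Y" for x y
    by (rule generate_commute[OF half carr]) (use that in blast)+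
  have "generate W (\<sigma> ` (A \<union> B)) \<subseteq> (\<lambda>(x, y). x \<otimes> y) ` (?X \<times> ?Y)"
  proof
    fix g
    assume "g \<in> generate W (\<sigma> ` (A \<union> B))"
    then have "\<exists>x\<in>?X. \<exists>y\<in>?Y. g = x \<otimes> y"
    proof (induction rule: generate.induct)
      case one
      then show ?case
        by (metis generate.one l_one one_closed)
    next
      case (incl h)
      then consider "h \<in> ?X" | "h \<in> ?Y"
        by (auto intro: generate.incl)
      then show ?case
        by cases (metis carr generate.one l_one r_one)+
    next
      case (inv h)
      then consider "inv h \<in> ?X" | "inv h \<in> ?Y"
        by (auto intro: generate.inv)
      then show ?case
        by cases (metis carr generate.one l_one r_one)+
    next
      case (eng g h)
      then obtain x y x' y' where xy: "x \<in> ?X" "y \<in> ?Y" "g = x \<otimes> y" "x' \<in> ?X" "y' \<in> ?Y" "h = x' \<otimes> y'"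
        by blast
      have c: "x \<in> carrier W" "y \<in> carrier W" "x' \<in> carrier W" "y' \<in> carrier W"
        using xy carr by auto
      have "g \<otimes> h = x \<otimes> (y \<otimes> x') \<otimes> y'"
        using c by (simp add: xy m_assoc)
      also have "\<dots> = x \<otimes> (x' \<otimes> y) \<otimes> y'"
        using comm[of x' y] xy by simp
      also have "\<dots> = (x \<otimes> x') \<otimes> (y \<otimes> y')"
        using c by (simp add: m_assoc)
      finally show ?case
        using xy by (meson generate.eng)
    qed
    then show "g \<in> (\<lambda>(x, y). x \<otimes> y) ` (?X \<times> ?Y)"
      by auto
  qed
  moreover have "finite ((\<lambda>(x, y). x \<otimes> y) ` (?X \<times> ?Y))"
    using assms(2,3) by (simp add: spherical_def carrier_special)
  ultimately show ?thesis
    by (simp add: spherical_def carrier_special finite_subset)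
qed

definition perp :: "'s set \<Rightarrow> 's set" where
  "perp A = {x. x \<notin> A \<and> (\<forall>a\<in>A. \<sigma> a \<otimes> \<sigma> x = \<sigma> x \<otimes> \<sigma> a)}"

abbreviation minimal :: "'s set \<Rightarrow> bool" where
  "minimal \<equiv> minimal_nonspherical W \<sigma>"

lemma disjoint_commuting_perp: "disjoint_commuting W \<sigma> A B \<longleftrightarrow> B \<subseteq> perp A"
  by (auto simp: disjoint_commuting_def perp_def)

lemma nonspherical_contains_minimal:
  assumes "nonspherical T"
  obtains M where "M \<subseteq> T" "minimal M"
proof -
  obtain M where M: "M \<in> {M. nonspherical M}" "M \<subseteq> T"
    "\<forall>U\<in>{M. nonspherical M}. U \<subseteq> M \<longrightarrow> M = U"
    using finite_has_minimal2[of "{M. nonspherical M}" T] assms by auto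
  then have "minimal M"
    by (auto simp: minimal_nonspherical_def)
  then show thesis
    using that M by blast
qed

text \<open>
  The two proper parts \<open>M \<inter> A\<close> and \<open>M \<inter> B\<close> would be spherical and commuting, and so would be their union.
\<close>

lemma minimal_within_factor:
  assumes "minimal M" "M \<subseteq> A \<union> B" "B \<subseteq> perp A"
  shows "M \<subseteq> A \<or> M \<subseteq> B"
proof (rule ccontr)
  assume "\<not> ?thesis"
  then have "M \<inter> A \<subset> M" "M \<inter> B \<subset> M"
    by auto
  then have "spherical W \<sigma> (M \<inter> A)" "spherical W \<sigma> (M \<inter> B)"
    using assms(1) by (auto simp: minimal_nonspherical_def)
  moreover have "disjoint_commuting W \<sigma> (M \<inter> A) (M \<inter> B)"
    using assms(3) by (auto simp: disjoint_commuting_def perp_def)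
  ultimately have "spherical W \<sigma> (M \<inter> A \<union> M \<inter> B)"
    by (intro spherical_Un)
  moreover have "M \<inter> A \<union> M \<inter> B = M"
    using assms(2) by blast
  ultimately show False
    using assms(1) by (simp add: minimal_nonspherical_def)
qed

lemma minimal_subset_eq: "minimal M \<Longrightarrow> minimal N \<Longrightarrow> M \<subseteq> N \<Longrightarrow> M = N"
  by (auto simp: minimal_nonspherical_def)

lemma minimal_imp_nonspherical: "minimal M \<Longrightarrow> nonspherical M"
  by (simp add: minimal_nonspherical_def)

text \<open>
  By \<open>noncommuting_dynkin_edge\<close>, these pairs are edges of the Dynkin diagram induced on \<open>T\<close>.
\<close>

definition noncommuting :: "'s set \<Rightarrow> ('s \<times> 's) set" where
  "noncommuting T = {(s, t). s \<in> T \<and> t \<in> T \<and> \<sigma> s \<otimes> \<sigma> t \<noteq> \<sigma> t \<otimes> \<sigma> s}"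

lemma noncommuting_mono: "S \<subseteq> T \<Longrightarrow> (noncommuting S)\<^sup>* \<subseteq> (noncommuting T)\<^sup>*"
  by (intro rtrancl_mono) (auto simp: noncommuting_def)

text \<open>
  Otherwise the component of \<open>u\<close> and its complement in \<open>M\<close> would commute, contrary to \<open>minimal_within_factor\<close>.
\<close>

lemma minimal_connected:
  assumes "minimal M" "u \<in> M" "v \<in> M"
  shows "(u, v) \<in> (noncommuting M)\<^sup>*"
proof -
  let ?A = "{w \<in> M. (u, w) \<in> (noncommuting M)\<^sup>*}"
  have "M - ?A \<subseteq> perp ?A"
  proof
    fix x
    assume x: "x \<in> M - ?A"
    have "\<sigma> w \<otimes> \<sigma> x = \<sigma> x \<otimes> \<sigma> w" if w: "w \<in> ?A" for w
    proof (rule ccontr)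
      assume "\<not> ?thesis"
      then have "(w, x) \<in> noncommuting M"
        using x w by (simp add: noncommuting_def)
      then show False
        using x w by (auto dest: rtrancl_into_rtrancl)
    qed
    then show "x \<in> perp ?A"
      using x by (simp add: perp_def)
  qed
  then have "M \<subseteq> ?A \<or> M \<subseteq> M - ?A"
    using assms(1) by (intro minimal_within_factor) auto
  then show ?thesis
    using assms(2,3) by auto
qed

section \<open>Members of level zero\<close>

abbreviation base :: "'s set set" where
  "base \<equiv> hypergraph_level W \<sigma> 0"

lemma maximal_sets_cover:
  assumes "T \<in> (C :: 's set set)"
  shows "\<exists>U\<in>maximal_sets C. T \<subseteq> U"
proof -
  obtain U where "U \<in> C" "T \<subseteq> U" "\<forall>V\<in>C. U \<subseteq> V \<longrightarrow> U = V"
    using finite_has_maximal2[of C T] assms by auto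
  then show ?thesis
    by (auto simp: maximal_sets_def intro!: bexI[of _ U])
qed

lemma base_covers_commuting_nonspherical:
  assumes "nonspherical A" "nonspherical B" "B \<subseteq> perp A"
  shows "\<exists>Y\<in>base. A \<union> B \<subseteq> Y"
proof -
  have "\<exists>Y\<in>wide_subsets W \<sigma>. A \<union> B \<subseteq> Y"
    unfolding wide_subsets_def
    by (rule maximal_sets_cover) (use assms in \<open>auto simp: disjoint_commuting_perp\<close>)
  then show ?thesis
    by auto
qed

text \<open>
  Adding one commuting generator to a minimal set gives a slab unless a wide set covers it already.
\<close>

lemma base_covers_commuting_element:
  assumes "minimal A" "x \<in> perp A"
  shows "\<exists>Y\<in>base. insert x A \<subseteq> Y"
proof (cases "spherical W \<sigma> {x}")
  case False
  then show ?thesis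
    using base_covers_commuting_nonspherical[of A "{x}"] assms by (simp add: minimal_nonspherical_def)
next
  case True
  show ?thesis
  proof (cases "\<exists>T\<in>wide_subsets W \<sigma>. A \<union> {x} \<subseteq> T")
    case True
    then show ?thesis by auto
  next
    case False
    then have "disjoint_commuting W \<sigma> A {x} \<and> minimal A \<and> {x} \<noteq> {} \<and> spherical W \<sigma> {x} \<and>
        \<not> (\<exists>T\<in>wide_subsets W \<sigma>. A \<union> {x} \<subseteq> T)"
      using assms \<open>spherical W \<sigma> {x}\<close> by (simp add: disjoint_commuting_perp)
    then have "\<exists>Y\<in>slab_subsets W \<sigma>. A \<union> {x} \<subseteq> Y"
      unfolding slab_subsets_def by (intro maximal_sets_cover) blast
    then show ?thesis by auto
  qed
qed

definition splits :: "'s set \<Rightarrow> bool" where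
  "splits X \<longleftrightarrow> (\<exists>M N. minimal M \<and> minimal N \<and> M \<inter> N = {} \<and> M \<subseteq> X \<and> N \<subseteq> X)"

definition cone_over :: "'s set \<Rightarrow> 's set \<Rightarrow> bool" where
  "cone_over A T \<longleftrightarrow> minimal A \<and> T \<subseteq> A \<union> perp A \<and> (\<forall>M. minimal M \<longrightarrow> M \<subseteq> T \<longrightarrow> M = A)"

lemma product_cone_over:
  assumes "minimal A" "K \<subseteq> perp A" "spherical W \<sigma> K"
  shows "cone_over A (A \<union> K)"
proof -
  have "M = A" if "minimal M" "M \<subseteq> A \<union> K" for M
    using minimal_within_factor[OF that assms(2)] minimal_subset_eq[OF that(1) assms(1)]
      spherical_mono[OF _ assms(3), of M] that(1)
    by (auto simp: minimal_nonspherical_def)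
  then show ?thesis
    using assms by (auto simp: cone_over_def)
qed

lemma splits_product:
  assumes "nonspherical A" "nonspherical B" "B \<subseteq> perp A"
  shows "splits (A \<union> B)"
proof -
  obtain M N where "M \<subseteq> A" "minimal M" "N \<subseteq> B" "minimal N"
    using assms nonspherical_contains_minimal by metis
  moreover have "A \<inter> B = {}"
    using assms(3) by (auto simp: perp_def)
  ultimately show ?thesis
    unfolding splits_def by blast
qed

text \<open>
  For wide sets of affine type this rests on \<open>affine_irreducible_minimal\<close>.
\<close>

lemma base_cases:
  assumes "X \<in> base"
  shows "splits X \<or> (\<exists>A\<subseteq>X. cone_over A X)"
proof -
  consider (wide) "X \<in> wide_subsets W \<sigma>" | (slab) "X \<in> slab_subsets W \<sigma>"
    using assms by auto
  then show ?thesis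
  proof cases
    case wide
    then obtain A B where X: "X = A \<union> B" "B \<subseteq> perp A"
      and AB: "nonspherical A \<and> nonspherical B \<or>
         irreducible_subset W \<sigma> A \<and> affine_subset W \<sigma> A \<and> 3 \<le> card A \<and> spherical W \<sigma> B"
      by (auto simp: wide_subsets_def maximal_sets_def disjoint_commuting_perp)
    show ?thesis
      using AB
    proof
      assume "nonspherical A \<and> nonspherical B"
      then show ?thesis
        using splits_product X by blast
    next
      assume *: "irreducible_subset W \<sigma> A \<and> affine_subset W \<sigma> A \<and> 3 \<le> card A \<and> spherical W \<sigma> B"
      then have "A \<noteq> {}"
        by auto
      then have "minimal A"
        using * affine_irreducible_minimal by blast
      then show ?thesis
        using product_cone_over X * by blast
    qed
  next
    case slab
    then obtain A K where "X = A \<union> K" "K \<subseteq> perp A" "minimal A" "spherical W \<sigma> K"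
      by (auto simp: slab_subsets_def maximal_sets_def disjoint_commuting_perp)
    then show ?thesis
      using product_cone_over by blast
  qed
qed

lemma base_nonspherical:
  assumes "X \<in> base"
  shows "nonspherical X"
proof -
  obtain M where "minimal M" "M \<subseteq> X"
    using base_cases[OF assms] by (auto simp: splits_def cone_over_def)
  then show ?thesis
    using spherical_mono by (auto simp: minimal_nonspherical_def)
qed

section \<open>Merging classes and their constituents\<close>

lemma equiv_merge_rel: "equiv L (merge_rel W \<sigma> L)"
proof -
  have sym: "sym {(T, U). T \<in> L \<and> U \<in> L \<and> nonspherical (T \<inter> U)}"
    by (auto simp: sym_def Int_commute)
  show ?thesis
    unfolding merge_rel_def
    by (intro equivI) (auto simp: refl_on_def intro!: symI transI dest: symD[OF sym_rtrancl[OF sym]])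
qed

lemma merge_class_subset: "C \<in> L // merge_rel W \<sigma> L \<Longrightarrow> C \<subseteq> L"
  by (auto simp: quotient_def merge_rel_def)

lemma merge_class_nonempty: "C \<in> L // merge_rel W \<sigma> L \<Longrightarrow> C \<noteq> {}"
  using in_quotient_imp_non_empty[OF equiv_merge_rel] .

lemma merge_relI:
  "T \<in> L \<Longrightarrow> U \<in> L \<Longrightarrow> nonspherical (T \<inter> U) \<Longrightarrow> (T, U) \<in> merge_rel W \<sigma> L"
  by (auto simp: merge_rel_def)

lemma merge_class_closed:
  assumes "C \<in> L // merge_rel W \<sigma> L" "Z \<in> C" "Z' \<in> L" "nonspherical (Z \<inter> Z')"
  shows "Z' \<in> C"
proof (rule in_quotient_imp_closed[OF equiv_merge_rel assms(1,2) merge_relI[OF _ assms(3,4)]])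
  show "Z \<in> L"
    using merge_class_subset[OF assms(1)] assms(2) by blast
qed

lemma merge_class_eqI:
  assumes "C \<in> L // merge_rel W \<sigma> L" "C' \<in> L // merge_rel W \<sigma> L"
    and "Z \<in> C" "Z' \<in> C'" "nonspherical (Z \<inter> Z')"
  shows "C = C'"
proof (rule quotient_eqI[OF equiv_merge_rel assms(1-4) merge_relI[OF _ _ assms(5)]])
  show "Z \<in> L" "Z' \<in> L"
    using merge_class_subset[OF assms(1)] merge_class_subset[OF assms(2)] assms(3,4) by blast+
qed

text \<open>
  Paths that witness the merging relation stay inside their class, so a property can be propagated
  along links between members of the class.
\<close>

lemma merge_class_induct:
  assumes "C \<in> L // merge_rel W \<sigma> L" "Z0 \<in> C" "P Z0" "Z \<in> C"
    and step: "\<And>Z Z'. Z \<in> C \<Longrightarrow> Z' \<in> C \<Longrightarrow> nonspherical (Z \<inter> Z') \<Longrightarrow> P Z \<Longrightarrow> P Z'"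
  shows "P Z"
proof -
  have "(Z0, Z) \<in> merge_rel W \<sigma> L"
    using assms(1,2,4) by (meson equiv_merge_rel in_quotient_imp_in_rel empty_subsetI insert_subset)
  then have "(Z0, Z) \<in> {(T, U). T \<in> L \<and> U \<in> L \<and> nonspherical (T \<inter> U)}\<^sup>*"
    by (simp add: merge_rel_def)
  then have "Z \<in> C \<and> P Z"
  proof induction
    case (step Y Z)
    then have "Z \<in> C"
      using merge_class_closed[OF assms(1), of Y Z] by auto
    then show ?case
      using step assms(5)[of Y Z] by auto
  qed (use assms in auto)
  then show ?thesis ..
qed

text \<open>
  This holds for merging classes of level 0 and is inherited by unions. In later levels it replaces the connectedness
  of the classes, which is lost: linked members of a later level need not have linked constituents.
\<close>

definition closed_family :: "'s set set \<Rightarrow> bool" where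
  "closed_family D \<longleftrightarrow> D \<subseteq> base \<and> (\<forall>X\<in>D. \<forall>Y\<in>base. nonspherical (X \<inter> Y) \<longrightarrow> Y \<in> D)"

lemma closed_familyD:
  assumes "closed_family D" "X \<in> D" "Y \<in> base" "minimal M" "M \<subseteq> X" "M \<subseteq> Y"
  shows "Y \<in> D"
proof -
  have "nonspherical (X \<inter> Y)"
    using spherical_mono[of M "X \<inter> Y"] assms(4-6) by (auto simp: minimal_nonspherical_def)
  then show ?thesis
    using assms(1-3) by (auto simp: closed_family_def)
qed

definition split_or_cone :: "'s set set \<Rightarrow> 's set \<Rightarrow> bool" where
  "split_or_cone D T \<longleftrightarrow> (\<exists>X\<in>D. splits X) \<or> (\<exists>A. cone_over A T)"

text \<open>
  If no constituent splits, every member of the class is a cone, and linked members have the same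
  apex because they share a minimal set. A minimal set of the union outside the common apex \<open>A\<close> would commute with
  \<open>A\<close>; by closedness the product of the two would lie in a constituent, which would split.
\<close>

lemma split_or_cone_class:
  assumes C: "C \<in> L // merge_rel W \<sigma> L"
    and nonempty: "\<And>Z. Z \<in> C \<Longrightarrow> d Z \<noteq> {}"
    and union: "\<And>Z. Z \<in> C \<Longrightarrow> \<Union> (d Z) = Z"
    and cases: "\<And>Z. Z \<in> C \<Longrightarrow> split_or_cone (d Z) Z"
    and closed: "closed_family (\<Union> (d ` C))"
  shows "split_or_cone (\<Union> (d ` C)) (\<Union> C)"
proof (cases "\<exists>X\<in>\<Union> (d ` C). splits X")
  case True
  then show ?thesis
    by (simp add: split_or_cone_def)
next
  case False
  then have cone: "\<exists>A. cone_over A Z" if "Z \<in> C" for Z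
    using cases[OF that] that by (auto simp: split_or_cone_def)
  obtain Z0 where Z0: "Z0 \<in> C"
    using merge_class_nonempty[OF C] by blast
  obtain A where A: "cone_over A Z0"
    using cone[OF Z0] by blast
  have all: "cone_over A Z" if "Z \<in> C" for Z
    using C Z0 A that
  proof (rule merge_class_induct)
    fix Y Z
    assume "Z \<in> C" and meet: "nonspherical (Y \<inter> Z)" and Y: "cone_over A Y"
    obtain B where B: "cone_over B Z"
      using cone \<open>Z \<in> C\<close> by blast
    obtain M where "M \<subseteq> Y \<inter> Z" "minimal M"
      using meet by (rule nonspherical_contains_minimal)
    then have "M = A" "M = B"
      using Y B by (auto simp: cone_over_def)
    then show "cone_over A Z"
      using B by simp
  qed
  have minA: "minimal A" and sub: "\<Union> C \<subseteq> A \<union> perp A"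
    using A all by (auto simp: cone_over_def)
  have "M = A" if M: "minimal M" "M \<subseteq> \<Union> C" for M
  proof -
    have "M \<subseteq> A \<or> M \<subseteq> perp A"
      using M sub by (intro minimal_within_factor) auto
    moreover have False if perp: "M \<subseteq> perp A"
    proof -
      obtain Y where Y: "Y \<in> base" "A \<union> M \<subseteq> Y"
        using base_covers_commuting_nonspherical[OF minimal_imp_nonspherical[OF minA]
            minimal_imp_nonspherical[OF M(1)] perp] by blast
      obtain X where X: "X \<in> d Z0"
        using nonempty[OF Z0] by fastforce
      have "X \<subseteq> Z0"
        using Union_upper[OF X] union[OF Z0] by simp
      have "X \<in> base"
        using closed X Z0 unfolding closed_family_def by (meson UN_I subsetD)
      then have "nonspherical X"
        by (rule base_nonspherical)
      then obtain N where "N \<subseteq> X" "minimal N"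
        using nonspherical_contains_minimal by blast
      then have "A \<subseteq> X"
        using A \<open>X \<subseteq> Z0\<close> unfolding cone_over_def by blast
      then have "Y \<in> \<Union> (d ` C)"
        using closed_familyD[OF closed _ Y(1) minA] X Z0 Y(2) by blast
      moreover have "splits Y"
        unfolding splits_def
      proof (intro exI conjI)
        show "A \<inter> M = {}"
          using perp by (auto simp: perp_def)
      qed (use minA M(1) Y(2) in simp_all)
      ultimately show False
        using False by blast
    qed
    ultimately show ?thesis
      using minimal_subset_eq[OF M(1) minA] by blast
  qed
  then have "cone_over A (\<Union> C)"
    using minA sub by (simp add: cone_over_def)
  then show ?thesis
    by (auto simp: split_or_cone_def)
qed

text \<open>
  The constituents of a class are collected from those of its members. Each constituent lies in a member of
  the class, which is what excludes constituents that contain a given minimal set.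
\<close>

lemma class_constituents:
  assumes "C \<in> hypergraph_level W \<sigma> j // merge_rel W \<sigma> (hypergraph_level W \<sigma> j)"
  shows "\<exists>D. D \<noteq> {} \<and> closed_family D \<and> \<Union> D = \<Union> C \<and> (\<forall>X\<in>D. \<exists>Z\<in>C. X \<subseteq> Z) \<and>
    split_or_cone D (\<Union> C)"
  using assms
proof (induction j arbitrary: C)
  case 0
  have CL: "C \<subseteq> base" "C \<noteq> {}"
    using merge_class_subset merge_class_nonempty 0 by auto
  have closed: "closed_family C"
    using CL merge_class_closed[OF 0] by (auto simp: closed_family_def)
  have "split_or_cone (\<Union> ((\<lambda>Z. {Z}) ` C)) (\<Union> C)"
  proof (rule split_or_cone_class[OF 0])
    fix Z
    assume "Z \<in> C"
    then show "split_or_cone {Z} Z"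
      using CL base_cases[of Z] unfolding split_or_cone_def by blast
  qed (use closed in simp_all)
  then show ?case
    using CL closed by (intro exI[of _ C]) auto
next
  case (Suc j)
  let ?L = "hypergraph_level W \<sigma> (Suc j)"
  define good where "good D Z \<longleftrightarrow> D \<noteq> {} \<and> closed_family D \<and> \<Union> D = Z \<and> split_or_cone D Z" for D Z
  have CL: "C \<subseteq> ?L" "C \<noteq> {}"
    using merge_class_subset[OF Suc.prems] merge_class_nonempty[OF Suc.prems] by auto
  have "\<exists>D. good D Z" if Z: "Z \<in> C" for Z
  proof -
    obtain C' where C': "C' \<in> hypergraph_level W \<sigma> j // merge_rel W \<sigma> (hypergraph_level W \<sigma> j)"
      "Z = \<Union> C'"
      using CL Z by auto
    obtain D where "D \<noteq> {}" "closed_family D" "\<Union> D = \<Union> C'" "split_or_cone D (\<Union> C')"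
      using Suc.IH[OF C'(1)] by (elim exE conjE)
    then have "good D Z"
      unfolding good_def C'(2) by (intro conjI)
    then show ?thesis ..
  qed
  then obtain d where d: "\<And>Z. Z \<in> C \<Longrightarrow> good (d Z) Z"
    by metis
  let ?D = "\<Union> (d ` C)"
  have closed: "closed_family ?D"
    unfolding closed_family_def
  proof (intro conjI ballI impI)
    have "d Z \<subseteq> base" if "Z \<in> C" for Z
      using d[OF that] by (simp add: good_def closed_family_def)
    then show "?D \<subseteq> base"
      by blast
  next
    fix X Y
    assume "X \<in> ?D" and Y: "Y \<in> base" "nonspherical (X \<inter> Y)"
    then obtain Z where Z: "Z \<in> C" "X \<in> d Z"
      by blast
    then have "Y \<in> d Z"
      using d[OF Z(1)] Y unfolding good_def closed_family_def by metis
    then show "Y \<in> ?D"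
      using Z(1) by blast
  qed
  have split: "split_or_cone ?D (\<Union> C)"
    by (rule split_or_cone_class[OF Suc.prems]) (use d closed in \<open>simp_all add: good_def\<close>)
  have union: "\<Union> (d Z) = Z" and nonempty: "d Z \<noteq> {}" if "Z \<in> C" for Z
    using d[OF that] unfolding good_def by simp_all
  have "\<Union> ?D = (\<Union>Z\<in>C. \<Union> (d Z))"
    by blast
  also have "\<dots> = \<Union> C"
    using union by simp
  finally have "\<Union> ?D = \<Union> C" .
  moreover note split
  moreover have "?D \<noteq> {}"
    using nonempty CL(2) by blast
  moreover have "\<forall>X\<in>?D. \<exists>Z\<in>C. X \<subseteq> Z"
    using union by (metis UN_E Union_upper)
  ultimately show ?case
    using closed by blast
qed

lemma level_nonspherical:
  assumes "T \<in> hypergraph_level W \<sigma> j"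
  shows "nonspherical T"
proof (cases j)
  case 0
  then show ?thesis
    using assms base_nonspherical by simp
next
  case (Suc i)
  then obtain C where C: "C \<in> hypergraph_level W \<sigma> i // merge_rel W \<sigma> (hypergraph_level W \<sigma> i)"
    "T = \<Union> C"
    using assms by auto
  obtain D X where "X \<in> D" "closed_family D" "\<Union> D = T"
    using class_constituents[OF C(1)] C(2) by blast
  then have "X \<in> base" "X \<subseteq> T"
    by (auto simp: closed_family_def)
  then show ?thesis
    using base_nonspherical spherical_mono by blast
qed

text \<open>
  Both facts used here come from closedness: a minimal set inside a constituent that commuted with \<open>M\<close>, or
  with \<open>x\<close>, would produce a constituent containing \<open>M\<close>, or \<open>x\<close>.
\<close>

lemma new_cycle:
  assumes "closed_family D" "D \<noteq> {}" "split_or_cone D (\<Union> D)"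
    and M: "minimal M" "M \<subseteq> \<Union> D" "\<And>X. X \<in> D \<Longrightarrow> \<not> M \<subseteq> X"
    and x: "x \<notin> \<Union> D"
  obtains u v where "u \<noteq> v" "(u, v) \<in> (noncommuting (\<Union> D))\<^sup>*" "u \<in> \<Union> D" "v \<in> \<Union> D"
    "\<sigma> u \<otimes> \<sigma> x \<noteq> \<sigma> x \<otimes> \<sigma> u" "\<sigma> v \<otimes> \<sigma> x \<noteq> \<sigma> x \<otimes> \<sigma> v"
proof -
  let ?T = "\<Union> D"
  have touch: "\<exists>w\<in>M. \<exists>e\<in>N. (w, e) \<in> (noncommuting ?T)\<^sup>* \<and> (e, w) \<in> (noncommuting ?T)\<^sup>*"
    if N: "minimal N" "X \<in> D" "N \<subseteq> X" for N X
  proof (rule ccontr)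
    assume neg: "\<not> ?thesis"
    have "\<sigma> w \<otimes> \<sigma> e = \<sigma> e \<otimes> \<sigma> w" if "w \<in> M" "e \<in> N" for w e
    proof (rule ccontr)
      assume "\<sigma> w \<otimes> \<sigma> e \<noteq> \<sigma> e \<otimes> \<sigma> w"
      then have "(w, e) \<in> noncommuting ?T" "(e, w) \<in> noncommuting ?T"
        using that N M(2) by (auto simp: noncommuting_def)
      then show False
        using neg that by blast
    qed
    moreover have "M \<inter> N = {}"
      using neg by blast
    ultimately have "N \<subseteq> perp M"
      by (auto simp: perp_def)
    then obtain Y where Y: "Y \<in> base" "M \<union> N \<subseteq> Y"
      using base_covers_commuting_nonspherical[of M N] minimal_imp_nonspherical M(1) N(1) by blast
    then have "Y \<in> D"
      using closed_familyD[OF assms(1) N(2) Y(1) N(1,3)] by auto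
    then show False
      using M(3) Y by blast
  qed
  have nbr: "\<exists>e\<in>N. \<sigma> e \<otimes> \<sigma> x \<noteq> \<sigma> x \<otimes> \<sigma> e" if N: "minimal N" "X \<in> D" "N \<subseteq> X" for N X
  proof (rule ccontr)
    assume "\<not> ?thesis"
    then have "x \<in> perp N"
      using x N by (auto simp: perp_def)
    then obtain Y where Y: "Y \<in> base" "insert x N \<subseteq> Y"
      using base_covers_commuting_element[OF N(1)] by blast
    then have "Y \<in> D"
      using closed_familyD[OF assms(1) N(2) Y(1) N(1,3)] by auto
    then show False
      using x Y by blast
  qed
  have "\<not> cone_over A ?T" for A
  proof
    assume A: "cone_over A ?T"
    obtain X where X: "X \<in> D"
      using assms(2) by blast
    then have "nonspherical X"
      using assms(1) base_nonspherical by (auto simp: closed_family_def)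
    then obtain N where "N \<subseteq> X" "minimal N"
      using nonspherical_contains_minimal by blast
    moreover from \<open>N \<subseteq> X\<close> X have "N \<subseteq> \<Union> D"
      by blast
    ultimately have "M = A" "N = A"
      using A M(1,2) unfolding cone_over_def by blast+
    then show False
      using M(3)[OF X] \<open>N \<subseteq> X\<close> by simp
  qed
  then obtain X N1 N2 where X: "X \<in> D" and N: "minimal N1" "minimal N2" "N1 \<inter> N2 = {}" "N1 \<subseteq> X" "N2 \<subseteq> X"
    using assms(3) unfolding split_or_cone_def splits_def by blast
  obtain u where u: "u \<in> N1" "\<sigma> u \<otimes> \<sigma> x \<noteq> \<sigma> x \<otimes> \<sigma> u"
    using nbr[OF N(1) X N(4)] by blast
  obtain v where v: "v \<in> N2" "\<sigma> v \<otimes> \<sigma> x \<noteq> \<sigma> x \<otimes> \<sigma> v"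
    using nbr[OF N(2) X N(5)] by blast
  obtain w1 e1 where 1: "w1 \<in> M" "e1 \<in> N1" "(e1, w1) \<in> (noncommuting ?T)\<^sup>*"
    using touch[OF N(1) X N(4)] by blast
  obtain w2 e2 where 2: "w2 \<in> M" "e2 \<in> N2" "(w2, e2) \<in> (noncommuting ?T)\<^sup>*"
    using touch[OF N(2) X N(5)] by blast
  have N12: "N1 \<subseteq> ?T" "N2 \<subseteq> ?T"
    using N X by auto
  have "(u, e1) \<in> (noncommuting ?T)\<^sup>*"
    using minimal_connected[OF N(1) u(1) 1(2)] noncommuting_mono[OF N12(1)] by blast
  moreover have "(w1, w2) \<in> (noncommuting ?T)\<^sup>*"
    using minimal_connected[OF M(1) 1(1) 2(1)] noncommuting_mono[OF M(2)] by blast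
  moreover have "(e2, v) \<in> (noncommuting ?T)\<^sup>*"
    using minimal_connected[OF N(2) 2(2) v(1)] noncommuting_mono[OF N12(2)] by blast
  ultimately have "(u, v) \<in> (noncommuting ?T)\<^sup>*"
    using 1(3) 2(3) by (meson rtrancl_trans)
  then show thesis
    using that[of u v] u v N N12 by blast
qed

section \<open>Growth of the first Betti number\<close>

text \<open>
  A largest member \<open>T0\<close> of the class is not all of \<open>T\<close>, since \<open>T\<close> is new. On a chain of links that starts
  at \<open>T0\<close>, the first member that is not contained in \<open>T0\<close> can be taken as \<open>T1\<close>.
\<close>

lemma incomparable_members:
  assumes "T \<in> hypergraph_level W \<sigma> (Suc i)" "T \<notin> hypergraph_level W \<sigma> i"
  obtains T0 T1 where "T0 \<in> hypergraph_level W \<sigma> i" "T1 \<in> hypergraph_level W \<sigma> i"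
    "T0 \<subseteq> T" "T1 \<subseteq> T" "\<not> T0 \<subseteq> T1" "\<not> T1 \<subseteq> T0" "nonspherical (T0 \<inter> T1)"
proof -
  let ?L = "hypergraph_level W \<sigma> i"
  obtain C where C: "C \<in> ?L // merge_rel W \<sigma> ?L" "T = \<Union> C"
    using assms(1) by auto
  have CL: "C \<subseteq> ?L"
    using merge_class_subset[OF C(1)] .
  obtain T0 where T0: "T0 \<in> C" "\<And>Z. Z \<in> C \<Longrightarrow> T0 \<subseteq> Z \<Longrightarrow> T0 = Z"
    using finite_has_maximal[of C] merge_class_nonempty[OF C(1)] by auto
  have "\<not> (\<forall>Z\<in>C. Z \<subseteq> T0)"
  proof
    assume "\<forall>Z\<in>C. Z \<subseteq> T0"
    then have "T = T0"
      using T0(1) C(2) by auto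
    then show False
      using assms(2) T0(1) CL by auto
  qed
  then obtain Z where Z: "Z \<in> C" "\<not> Z \<subseteq> T0"
    by blast
  have "\<exists>T1\<in>C. \<not> T1 \<subseteq> T0 \<and> nonspherical (T0 \<inter> T1)"
  proof (rule ccontr)
    assume none: "\<not> ?thesis"
    have "Z \<subseteq> T0"
    proof (rule merge_class_induct[where P = "\<lambda>Z. Z \<subseteq> T0", OF C(1) T0(1) subset_refl Z(1)])
      fix Y Z
      assume "Y \<in> C" "Z \<in> C" "nonspherical (Y \<inter> Z)" "Y \<subseteq> T0"
      then have "nonspherical (T0 \<inter> Z)"
        using spherical_mono[of "Y \<inter> Z" "T0 \<inter> Z"] by blast
      then show "Z \<subseteq> T0"
        using none \<open>Z \<in> C\<close> by blast
    qed
    then show False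
      using Z by simp
  qed
  then obtain T1 where T1: "T1 \<in> C" "\<not> T1 \<subseteq> T0" "nonspherical (T0 \<inter> T1)"
    by blast
  have "\<not> T0 \<subseteq> T1"
    using T0(2) T1 by blast
  moreover have "T0 \<in> ?L" "T1 \<in> ?L" "T0 \<subseteq> T" "T1 \<subseteq> T"
    using T0(1) T1(1) CL C(2) by auto
  ultimately show thesis
    using that T1(2,3) by blast
qed

text \<open>
  Of the two classes behind \<open>T0\<close> and \<open>T1\<close>, one has no member that contains \<open>M\<close>. Its union is new, for
  otherwise it would be a member of its own class and contain \<open>M\<close>.
\<close>

lemma first_betti_grows:
  fixes E :: "'s set set"
  assumes E: "edges_within UNIV E" "\<And>s t. \<sigma> s \<otimes> \<sigma> t \<noteq> \<sigma> t \<otimes> \<sigma> s \<Longrightarrow> {s, t} \<in> E"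
  assumes "T \<in> hypergraph_level W \<sigma> (Suc i)" "T \<notin> hypergraph_level W \<sigma> i"
  shows "int i \<le> first_betti T (induced_edges E T)"
  using assms(3,4)
proof (induction i arbitrary: T)
  case 0
  then show ?case
    using first_betti_nonneg[OF _ edges_within_induced[OF E(1)]] by simp
next
  case (Suc i)
  let ?L = "hypergraph_level W \<sigma> i"
  obtain T0 T1 where mem: "T0 \<in> hypergraph_level W \<sigma> (Suc i)" "T1 \<in> hypergraph_level W \<sigma> (Suc i)"
    and sub: "T0 \<subseteq> T" "T1 \<subseteq> T" and inc: "\<not> T0 \<subseteq> T1" "\<not> T1 \<subseteq> T0"
    and meet: "nonspherical (T0 \<inter> T1)"
    using incomparable_members[OF Suc.prems] by metis
  obtain M where M: "M \<subseteq> T0 \<inter> T1" "minimal M"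
    using meet by (rule nonspherical_contains_minimal)
  obtain C0 C1 where C0: "C0 \<in> ?L // merge_rel W \<sigma> ?L" "T0 = \<Union> C0"
    and C1: "C1 \<in> ?L // merge_rel W \<sigma> ?L" "T1 = \<Union> C1"
    using mem by auto
  have "\<not> ((\<exists>Z\<in>C0. M \<subseteq> Z) \<and> (\<exists>Z\<in>C1. M \<subseteq> Z))"
  proof
    assume "(\<exists>Z\<in>C0. M \<subseteq> Z) \<and> (\<exists>Z\<in>C1. M \<subseteq> Z)"
    then obtain Z Z' where Z: "Z \<in> C0" "Z' \<in> C1" "M \<subseteq> Z \<inter> Z'"
      by blast
    then have "nonspherical (Z \<inter> Z')"
      using spherical_mono[OF Z(3)] minimal_imp_nonspherical[OF M(2)] by blast
    then have "C0 = C1"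
      using merge_class_eqI[OF C0(1) C1(1) Z(1,2)] by simp
    then show False
      using inc C0 C1 by simp
  qed
  then obtain C x where C: "C \<in> ?L // merge_rel W \<sigma> ?L" "\<not> (\<exists>Z\<in>C. M \<subseteq> Z)" "M \<subseteq> \<Union> C"
    "\<Union> C \<subseteq> T" "x \<in> T" "x \<notin> \<Union> C"
    using C0 C1 inc sub M(1) by blast
  let ?T = "\<Union> C"
  have new: "?T \<notin> ?L"
  proof
    assume T: "?T \<in> ?L"
    obtain Z where Z: "Z \<in> C"
      using merge_class_nonempty[OF C(1)] by blast
    then have "Z \<inter> ?T = Z" "nonspherical Z"
      using level_nonspherical merge_class_subset[OF C(1)] by auto
    then have "?T \<in> C"
      using merge_class_closed[OF C(1) Z T] by simp
    then show False
      using C(2,3) by blast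
  qed
  obtain D where D: "D \<noteq> {}" "closed_family D" "\<Union> D = ?T" "\<forall>X\<in>D. \<exists>Z\<in>C. X \<subseteq> Z"
    "split_or_cone D ?T"
    using class_constituents[OF C(1)] by (elim exE conjE)
  have noX: "\<not> M \<subseteq> X" if "X \<in> D" for X
    using D(4) C(2) that by (meson order_trans)
  have cycle: "split_or_cone D (\<Union> D)" "M \<subseteq> \<Union> D" "x \<notin> \<Union> D"
    using D(3,5) C(3,6) by simp_all
  obtain u v where uv: "u \<noteq> v" "(u, v) \<in> (noncommuting ?T)\<^sup>*" "u \<in> ?T" "v \<in> ?T"
    "\<sigma> u \<otimes> \<sigma> x \<noteq> \<sigma> x \<otimes> \<sigma> u" "\<sigma> v \<otimes> \<sigma> x \<noteq> \<sigma> x \<otimes> \<sigma> v"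
    by (rule new_cycle[OF D(2,1) cycle(1) M(2) cycle(2) noX cycle(3), unfolded D(3)])
  note within = edges_within_induced[OF E(1)]
  have "noncommuting ?T \<subseteq> adjacency (induced_edges E ?T)"
    using E(2) by (auto simp: noncommuting_def induced_edges_def)
  then have conn: "(u, v) \<in> connectivity ?T (induced_edges E ?T)"
    using uv(2-4) rtrancl_mono[of "noncommuting ?T"] by (auto simp: connectivity_def)
  have "first_betti ?T (induced_edges E ?T) + 1
      \<le> first_betti (insert x ?T) (induced_edges E (insert x ?T))"
  proof (rule first_betti_new_cycle[OF _ within C(6) conn uv(1) within])
    show "{u, x} \<in> induced_edges E (insert x ?T)" "{v, x} \<in> induced_edges E (insert x ?T)"
      using E(2)[OF uv(5)] E(2)[OF uv(6)] uv(3,4) by (simp_all add: induced_edges_def)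
    show "induced_edges E ?T \<subseteq> induced_edges E (insert x ?T)"
      unfolding induced_edges_def by blast
  qed simp_all
  also have "\<dots> \<le> first_betti T (induced_edges E T)"
  proof (rule first_betti_mono[OF _ within within])
    show "insert x ?T \<subseteq> T"
      using C(4,5) by simp
    then show "induced_edges E (insert x ?T) \<subseteq> induced_edges E T"
      unfolding induced_edges_def by blast
  qed simp
  finally have "first_betti ?T (induced_edges E ?T) + 1 \<le> first_betti T (induced_edges E T)" .
  moreover have "int i \<le> first_betti ?T (induced_edges E ?T)"
    using Suc.IH[of ?T] C(1) new by auto
  ultimately show ?case
    by simp
qed

end

section \<open>The bound on the hypergraph index\<close>

lemma edges_within_dynkin: "edges_within UNIV (dynkin_edges m)"
  by (auto simp: edges_within_def dynkin_edges_def)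

lemma coxeter_relation:
  assumes "coxeter_system W \<sigma> m" "m s t = enat k"
  shows "word_val W \<sigma> (concat (replicate k [s, t])) = \<one>\<^bsub>W\<^esub>"
proof -
  have "delete_relator m ([] @ concat (replicate k [s, t]) @ []) ([] @ [])"
    using assms(2) by (rule delete_relator.intros)
  then have "equivclp (delete_relator m) (concat (replicate k [s, t])) []"
    by (simp add: r_into_equivclp)
  then have "word_val W \<sigma> (concat (replicate k [s, t])) = word_val W \<sigma> []"
    using assms(1) by (simp add: coxeter_system_def)
  then show ?thesis
    by (simp add: word_val_def)
qed

lemma coxeter_system_involution_family:
  assumes "coxeter_system W \<sigma> m"
  shows "involution_family W \<sigma>"
proof -
  interpret group W
    using assms by (simp add: coxeter_system_def)
  have closed: "\<sigma> s \<in> carrier W" for s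
    using assms by (auto simp: coxeter_system_def)
  have "\<sigma> s \<otimes>\<^bsub>W\<^esub> \<sigma> s = \<one>\<^bsub>W\<^esub>" for s
  proof -
    have "m s s = enat 1"
      using assms by (simp add: coxeter_system_def coxeter_matrix_def one_enat_def)
    then show ?thesis
      using coxeter_relation[OF assms, of s s 1] closed by (simp add: word_val_def)
  qed
  then show ?thesis
    using closed by unfold_locales
qed

text \<open>
  If \<open>m s t = 2\<close> then \<open>\<sigma> s \<otimes> \<sigma> t\<close> is its own inverse, which is \<open>\<sigma> t \<otimes> \<sigma> s\<close>.
\<close>

lemma noncommuting_dynkin_edge:
  assumes "coxeter_system W \<sigma> m" "\<sigma> s \<otimes>\<^bsub>W\<^esub> \<sigma> t \<noteq> \<sigma> t \<otimes>\<^bsub>W\<^esub> \<sigma> s"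
  shows "{s, t} \<in> dynkin_edges m"
proof -
  interpret involution_family W \<sigma>
    using assms(1) by (rule coxeter_system_involution_family)
  let ?g = "\<sigma> s \<otimes>\<^bsub>W\<^esub> \<sigma> t"
  have "s \<noteq> t"
    using assms(2) by auto
  have "m s t \<noteq> 2"
  proof
    assume "m s t = 2"
    then have "m s t = enat 2"
      by (simp add: numeral_eq_enat)
    then have "?g \<otimes>\<^bsub>W\<^esub> ?g = \<one>\<^bsub>W\<^esub>"
      using coxeter_relation[OF assms(1), of s t 2] \<sigma>_closed
      by (simp add: word_val_def numeral_2_eq_2 m_assoc)
    then have "?g = inv\<^bsub>W\<^esub> ?g"
      by (simp add: \<sigma>_closed inv_equality)
    also have "\<dots> = \<sigma> t \<otimes>\<^bsub>W\<^esub> \<sigma> s"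
      by (simp add: \<sigma>_closed inv_mult_group inv_\<sigma>)
    finally show False
      using assms(2) by simp
  qed
  moreover have "2 \<le> m s t"
    using assms(1) \<open>s \<noteq> t\<close> by (simp add: coxeter_system_def coxeter_matrix_def)
  ultimately have "3 \<le> m s t"
    by (cases "m s t") (auto simp: numeral_eq_enat)
  then show ?thesis
    using \<open>s \<noteq> t\<close> by (auto simp: dynkin_edges_def)
qed

theorem theorem1p7:
  fixes W :: "('w, 'b) monoid_scheme"
    and \<sigma> :: "'s::finite \<Rightarrow> 'w"
    and m :: "'s \<Rightarrow> 's \<Rightarrow> enat"
    and h :: nat
  assumes "coxeter_system W \<sigma> m"
    and "hypergraph_index W \<sigma> = enat h"
  shows "int h \<le> first_betti (UNIV :: 's set) (dynkin_edges m) + 1"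
proof -
  interpret involution_family W \<sigma>
    using assms(1) by (rule coxeter_system_involution_family)
  have ind: "induced_edges (dynkin_edges m) UNIV = dynkin_edges m"
    by (simp add: induced_edges_def)
  have "\<exists>h. enters_at_level W \<sigma> h" and h: "h = (LEAST h. enters_at_level W \<sigma> h)"
    using assms(2) by (auto simp: hypergraph_index_def split: if_splits)
  then have enters: "enters_at_level W \<sigma> h"
    by (metis LeastI)
  show ?thesis
  proof (cases h)
    case 0
    then show ?thesis
      using first_betti_nonneg[OF _ edges_within_dynkin, of m] by simp
  next
    case (Suc i)
    then have "UNIV \<in> hypergraph_level W \<sigma> (Suc i)" "UNIV \<notin> hypergraph_level W \<sigma> i"
      using enters unfolding enters_at_level_def by simp_all
    then have "int i \<le> first_betti UNIV (induced_edges (dynkin_edges m) UNIV)"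
      using first_betti_grows[of "dynkin_edges m" UNIV i] edges_within_dynkin
        noncommuting_dynkin_edge[OF assms(1)] by blast
    then show ?thesis
      using Suc ind by simp
  qed
qed

end
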